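(* Let $g,h\ge 0$ be integers and let $R\cup B$ be a double chain with $|R|=3g+h$ red points and $|B|=g+3h$ blue points, in general position. Then $R\cup B$ can be $K_{1,3}$-covered.
   Context: General position: no three points collinear. A point set is a double chain if it is the disjoint union of two non-empty sets $C_1$ and $C_2$, each in convex position (convex chains), facing each other in the sense that for every $p\in C_1$ and $q\in C_2$ the segment $pq$ does not cross $conv(C_1)$ nor $conv(C_2)$ (it meets $conv(C_1)$ only at $p$ and $conv(C_2)$ only at $q$). A set $X$ of red and blue points can be $K_{1,3}$-covered if $X$ can be partitioned into subsets of size $4$, each consisting of one point (the center) of one color and three points of the other color, such that the straight-line segments joining each center to the three other points of its subset are pairwise non-crossing (no two intersect except at a common endpoint). *)

theory Defs
  imports "HOL-Analysis.Analysis" "HOL-Library.Disjoint_Sets"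
begin

definition general_position :: "(real^2) set \<Rightarrow> bool" where
  "general_position X \<longleftrightarrow>
     (\<forall>a\<in>X. \<forall>b\<in>X. \<forall>c\<in>X. a \<noteq> b \<and> a \<noteq> c \<and> b \<noteq> c \<longrightarrow> \<not> collinear {a, b, c})"

definition convex_position :: "(real^2) set \<Rightarrow> bool" where
  "convex_position C \<longleftrightarrow> (\<forall>p\<in>C. p \<notin> convex hull (C - {p}))"

definition double_chain :: "(real^2) set \<Rightarrow> bool" where
  "double_chain X \<longleftrightarrow>
     (\<exists>C1 C2. X = C1 \<union> C2 \<and> C1 \<inter> C2 = {} \<and> C1 \<noteq> {} \<and> C2 \<noteq> {} \<and>
        convex_position C1 \<and> convex_position C2 \<and>
        (\<forall>p\<in>C1. \<forall>q\<in>C2.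
           closed_segment p q \<inter> convex hull C1 = {p} \<and>
           closed_segment p q \<inter> convex hull C2 = {q}))"

definition noncrossing :: "(real^2) \<times> (real^2) \<Rightarrow> (real^2) \<times> (real^2) \<Rightarrow> bool" where
  "noncrossing e f \<longleftrightarrow>
     closed_segment (fst e) (snd e) \<inter> closed_segment (fst f) (snd f)
       \<subseteq> {fst e, snd e} \<inter> {fst f, snd f}"

text \<open>\<open>ctr S\<close> is the center of the block \<open>S\<close>; an edge is a pair (center, leaf).\<close>

definition star_edges :: "(real^2) set set \<Rightarrow> ((real^2) set \<Rightarrow> real^2) \<Rightarrow> ((real^2) \<times> (real^2)) set" where
  "star_edges P ctr = {(ctr S, x) | S x. S \<in> P \<and> x \<in> S - {ctr S}}"

definition K13_coverable :: "(real^2) set \<Rightarrow> (real^2) set \<Rightarrow> bool" where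
  "K13_coverable R B \<longleftrightarrow>
     (\<exists>P ctr. partition_on (R \<union> B) P \<and>
        (\<forall>S\<in>P. card S = 4 \<and> ctr S \<in> S \<and>
           (ctr S \<in> R \<and> S - {ctr S} \<subseteq> B \<or> ctr S \<in> B \<and> S - {ctr S} \<subseteq> R)) \<and>
        pairwise noncrossing (star_edges P ctr))"

end

theory Submission
  imports Defs
begin

text \<open>
  A star is peeled off such that none of its edges meets a segment between two remaining points, and
  the rest is covered by induction; the invariant is that both chains stay nonempty or that one of
  \<open>g\<close> and \<open>h\<close> is \<open>0\<close>.

  Edges within a chain never meet edges of the other chain or cross edges, so any four points that are
  consecutive in the cyclic order of a chain and coloured 3:1 can be peeled off. The number of red
  points changes by at most one from a window of four consecutive points to the next. Hence, if
  \<open>g, h > 0\<close> and no window is coloured 3:1, each sufficiently large chain is monochromatic or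
  has exactly two red points in every window. In the second case three consecutive points around an
  end of the chain form, together with the facing end point of the other chain, a star
  that can be peeled off; if both chains are monochromatic, an end point is joined to the first three
  points of the other chain. If \<open>g = 0\<close>, a window with exactly one red point is used, and when there is
  none, one chain is blue and the other one has two red points in every window.
\<close>

section \<open>Orientation of point triples\<close>

text \<open>Why both chains must survive while \<open>g, h > 0\<close>: eight points in convex
  position with alternating colours have \<open>g = h = 1\<close> and no cover, since two
  non-crossing stars would occupy two arcs of four consecutive points. If \<open>g = 0\<close>, a
  single chain suffices: every point lies in four windows, so the windows contain one red point on
  average, and a count that changes by at most one cannot jump over 1. A red-centred star lowers
  \<open>h\<close> by one and a blue-centred one lowers \<open>g\<close>; hence for
  \<open>g = 0\<close> the centre has to be red. For \<open>g = h = 1\<close> a chain may be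
  emptied, because the remaining four points are coloured 3:1 and form a star anyway.

  The geometric obstacle is that the definition of a double chain is weaker than the usual picture.
  The diagonals of a convex quadrilateral are two chains in its sense, although they cross; a fifth
  point is needed to exclude crossing chords. Moreover, the opposite chain need not look the same
  from all points of a chain, so the stars available at the common end depend on where the view
  changes.\<close>

definition orient :: "real^2 \<Rightarrow> real^2 \<Rightarrow> real^2 \<Rightarrow> real" where
  "orient a b c = (b$1 - a$1) * (c$2 - a$2) - (b$2 - a$2) * (c$1 - a$1)"

lemma orient_rotate: "orient a b c = orient b c a"
  by (simp add: orient_def algebra_simps)

lemma orient_swap: "orient a b c = - orient b a c"
  by (simp add: orient_def algebra_simps)

lemma orient_swap': "orient a b c = - orient a c b"
  by (simp add: orient_def algebra_simps)

lemma orient_triv [simp]: "orient a a c = 0" "orient a b a = 0" "orient a b b = 0"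
  by (simp_all add: orient_def)

lemma orient_convex_comb:
  "orient a b ((1 - u) *\<^sub>R x + u *\<^sub>R y) = (1 - u) * orient a b x + u * orient a b y"
  by (simp add: orient_def algebra_simps)

text \<open>The three-term Grassmann-Pluecker relation for the four vectors from \<open>x\<close>;
  it is used to transfer known signs to an unknown orientation.\<close>

lemma orient_plucker:
  "orient x u v * orient x y z = orient x u y * orient x v z - orient x u z * orient x v y"
  by (simp add: orient_def algebra_simps)

lemma orient_zero_collinear:
  assumes "orient a b c = 0"
  shows "collinear {a, b, c}"
proof (cases "b = a")
  case True
  then show ?thesis by simp
next
  case False
  \<comment> \<open>The coefficient of the orthogonal projection of \<open>c - a\<close> to the
    direction \<open>b - a\<close>; a vanishing \<open>orient a b c\<close> makes
    \<open>c - a\<close> equal to its projection.\<close>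
  define k where "k = ((c - a) \<bullet> (b - a)) / ((b - a) \<bullet> (b - a))"
  have nz: "(b - a) \<bullet> (b - a) \<noteq> 0" using False by simp
  have "((b - a) \<bullet> (b - a)) *\<^sub>R (c - a) = ((c - a) \<bullet> (b - a)) *\<^sub>R (b - a)"
  proof -
    have o: "(b$1 - a$1) * (c$2 - a$2) = (b$2 - a$2) * (c$1 - a$1)"
      using assms by (simp add: orient_def)
    have 1: "((b - a) \<bullet> (b - a)) * (c$1 - a$1) = ((c - a) \<bullet> (b - a)) * (b$1 - a$1)"
      using o by (simp add: inner_vec_def sum_2) algebra
    have 2: "((b - a) \<bullet> (b - a)) * (c$2 - a$2) = ((c - a) \<bullet> (b - a)) * (b$2 - a$2)"
      using o by (simp add: inner_vec_def sum_2) algebra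
    show ?thesis using 1 2 by (simp add: vec_eq_iff forall_2)
  qed
  then have "inverse ((b - a) \<bullet> (b - a)) *\<^sub>R (((b - a) \<bullet> (b - a)) *\<^sub>R (c - a))
      = inverse ((b - a) \<bullet> (b - a)) *\<^sub>R (((c - a) \<bullet> (b - a)) *\<^sub>R (b - a))"
    by (rule arg_cong)
  then have "c - a = k *\<^sub>R (b - a)"
    unfolding scaleR_scaleR left_inverse[OF nz] by (simp add: k_def divide_inverse mult.commute)
  then have "c = (1 - k) *\<^sub>R a + k *\<^sub>R b" by (simp add: algebra_simps)
  then have "collinear {a, c, b}"
    unfolding collinear_3_expand by (intro disjI2 exI[of _ "1 - k"]) simp
  then show ?thesis by (simp add: insert_commute)
qed

lemma general_position_orient:
  assumes "general_position X" "a \<in> X" "b \<in> X" "c \<in> X" "a \<noteq> b" "a \<noteq> c" "b \<noteq> c"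
  shows "orient a b c \<noteq> 0"
  using assms orient_zero_collinear unfolding general_position_def by blast

lemma segment_disjoint_same_side:
  assumes "orient a b x * orient a b y > 0"
  shows "closed_segment a b \<inter> closed_segment x y = {}"
proof (rule ccontr)
  assume "\<not> ?thesis"
  then obtain u v where u: "0 \<le> u" "u \<le> 1" and v: "0 \<le> v" "v \<le> 1"
    and e: "(1 - u) *\<^sub>R a + u *\<^sub>R b = (1 - v) *\<^sub>R x + v *\<^sub>R y"
    by (auto simp: in_segment)
  have "orient a b ((1 - u) *\<^sub>R a + u *\<^sub>R b) = 0"
    by (simp add: orient_convex_comb)
  then have z: "(1 - v) * orient a b x + v * orient a b y = 0"
    unfolding e by (simp add: orient_convex_comb)
  consider "orient a b x > 0" "orient a b y > 0" | "orient a b x < 0" "orient a b y < 0"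
    using assms by (auto simp: zero_less_mult_iff)
  then show False
  proof cases
    case 1
    then have "(1 - v) * orient a b x \<ge> 0" "v * orient a b y \<ge> 0" using v by auto
    then have "(1 - v) * orient a b x = 0" "v * orient a b y = 0" using z by linarith+
    then show False using 1 by auto
  next
    case 2
    then have "(1 - v) * orient a b x \<le> 0" "v * orient a b y \<le> 0"
      using v by (auto simp: mult_nonneg_nonpos)
    then have "(1 - v) * orient a b x = 0" "v * orient a b y = 0" using z by linarith+
    then show False using 2 by auto
  qed
qed

text \<open>The line through \<open>b\<close> and \<open>c\<close> separates the segments: they lie
  in opposite closed half-planes and touch the line only in \<open>c\<close> and only in
  \<open>b\<close>.\<close>

lemma segment_disjoint_opposite_sides:
  assumes "orient b c a * orient b c d < 0"
  shows "closed_segment a c \<inter> closed_segment b d = {}"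
proof (rule ccontr)
  let ?P = "orient b c a" and ?Q = "orient b c d"
  assume "\<not> ?thesis"
  then obtain u v where u: "0 \<le> u" "u \<le> 1" and v: "0 \<le> v" "v \<le> 1"
    and e: "(1 - u) *\<^sub>R a + u *\<^sub>R c = (1 - v) *\<^sub>R b + v *\<^sub>R d"
    by (auto simp: in_segment)
  have "orient b c ((1 - u) *\<^sub>R a + u *\<^sub>R c) = (1 - u) * ?P"
    by (simp add: orient_convex_comb)
  moreover have "orient b c ((1 - v) *\<^sub>R b + v *\<^sub>R d) = v * ?Q"
    by (simp add: orient_convex_comb)
  ultimately have eq: "(1 - u) * ?P = v * ?Q" using e by simp
  have "(1 - u) * (?P * ?P) = ((1 - u) * ?P) * ?P" by simp
  also have "\<dots> = v * (?P * ?Q)" unfolding eq by simp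
  also have "\<dots> \<le> 0" using assms v by (simp add: mult_nonneg_nonpos)
  finally have "(1 - u) * (?P * ?P) \<le> 0" .
  moreover have "?P * ?P > 0" using assms by (auto simp: zero_less_mult_iff mult_less_0_iff)
  ultimately have "u = 1" using u by (smt (verit) mult_pos_pos)
  moreover have "v = 0" using eq \<open>u = 1\<close> assms by auto
  ultimately have "c = b" using e by simp
  then show False using assms by simp
qed

lemma segments_cross:
  assumes "orient a b c < 0" "orient a b d > 0" "orient c d a > 0" "orient c d b < 0"
  shows "closed_segment a b \<inter> closed_segment c d \<noteq> {}"
proof -
  \<comment> \<open>Cramer's rule: \<open>u\<close> is the zero of the affine function
    \<open>orient c d\<close> along \<open>ab\<close>, and \<open>v\<close> that of
    \<open>orient a b\<close> along \<open>cd\<close>. Both denominators turn out to be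
    equal.\<close>
  define u where "u = orient c d a / (orient c d a - orient c d b)"
  define v where "v = - orient a b c / (orient a b d - orient a b c)"
  have p: "orient c d a - orient c d b > 0" "orient a b d - orient a b c > 0" using assms by auto
  have eq: "orient c d a - orient c d b = orient a b d - orient a b c"
    by (simp add: orient_def algebra_simps)
  have u: "0 \<le> u" "u \<le> 1" and v: "0 \<le> v" "v \<le> 1"
    using assms p by (auto simp: u_def v_def divide_simps)
  define D where "D = orient a b d - orient a b c"
  have D: "D > 0" using p D_def by simp
  have uD: "u * D = orient c d a" and vD: "v * D = - orient a b c"
    using p eq by (auto simp: u_def v_def D_def)
  have comp: "(1 - u) * a$i + u * b$i = (1 - v) * c$i + v * d$i" if "i = 1 \<or> i = 2" for i
  proof -
    have "D * ((1 - u) * a$i + u * b$i) = (D - u * D) * a$i + (u * D) * b$i"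
      by (simp add: algebra_simps)
    also have "\<dots> = (D - v * D) * c$i + (v * D) * d$i"
      unfolding uD vD unfolding D_def orient_def using that by (auto simp: algebra_simps)
    also have "\<dots> = D * ((1 - v) * c$i + v * d$i)" by (simp add: algebra_simps)
    finally show ?thesis using D by simp
  qed
  have "(1 - u) *\<^sub>R a + u *\<^sub>R b = (1 - v) *\<^sub>R c + v *\<^sub>R d"
    using comp by (simp add: vec_eq_iff forall_2)
  then have "(1 - u) *\<^sub>R a + u *\<^sub>R b \<in> closed_segment a b \<inter> closed_segment c d"
    using u v by (auto simp: in_segment)
  then show ?thesis by blast
qed

lemma in_triangle:
  assumes "orient v x y > 0" "orient v y z > 0" "orient v z x > 0"
  shows "v \<in> convex hull {x, y, z}"
proof -
  define D where "D = orient v x y + orient v y z + orient v z x"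
  have D: "D > 0" using assms D_def by simp
  \<comment> \<open>Barycentric coordinates of \<open>v\<close>, as ratios of areas.\<close>
  define \<alpha> \<beta> \<gamma> where d: "\<alpha> = orient v y z / D" "\<beta> = orient v z x / D" "\<gamma> = orient v x y / D"
  have pos: "\<alpha> \<ge> 0" "\<beta> \<ge> 0" "\<gamma> \<ge> 0" using assms D by (auto simp: d)
  have "\<alpha> + \<beta> + \<gamma> = (orient v y z + orient v z x + orient v x y) / D"
    by (simp add: d add_divide_distrib)
  then have one: "\<alpha> + \<beta> + \<gamma> = 1" using D by (simp add: D_def add.commute add.left_commute)
  have aD: "\<alpha> * D = orient v y z" "\<beta> * D = orient v z x" "\<gamma> * D = orient v x y"
    using D by (auto simp: d)
  have comp: "v$i = \<alpha> * x$i + \<beta> * y$i + \<gamma> * z$i" if "i = 1 \<or> i = 2" for i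
  proof -
    have "D * (\<alpha> * x$i + \<beta> * y$i + \<gamma> * z$i) = (\<alpha> * D) * x$i + (\<beta> * D) * y$i + (\<gamma> * D) * z$i"
      by (simp add: algebra_simps)
    also have "\<dots> = D * v$i"
      unfolding aD unfolding D_def orient_def using that by (auto simp: algebra_simps)
    finally show ?thesis using D by simp
  qed
  then have "v = \<alpha> *\<^sub>R x + \<beta> *\<^sub>R y + \<gamma> *\<^sub>R z"
    by (simp add: vec_eq_iff forall_2)
  then show ?thesis unfolding convex_hull_3 using pos one by blast
qed

lemma segment_subset_hull: "a \<in> C \<Longrightarrow> b \<in> C \<Longrightarrow> closed_segment a b \<subseteq> convex hull C"
  by (meson convex_contains_segment convex_convex_hull hull_inc)

text \<open>As \<open>q\<close> is outside the hull, all directions from \<open>q\<close> to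
  \<open>C\<close> lie in an open half-plane, where positive orientation is a linear order.\<close>

lemma angular_sort:
  fixes C :: "(real^2) set"
  assumes fin: "finite C" and q: "q \<notin> convex hull C"
    and gp: "\<And>x y. x \<in> C \<Longrightarrow> y \<in> C \<Longrightarrow> x \<noteq> y \<Longrightarrow> orient q x y \<noteq> 0"
  obtains us where "distinct us" "set us = C"
    "\<And>i j. i < j \<Longrightarrow> j < length us \<Longrightarrow> orient q (us!i) (us!j) > 0"
proof -
  have "closed (convex hull C)" using fin by (simp add: finite_imp_compact_convex_hull compact_imp_closed)
  then obtain n b where n: "n \<bullet> q < b" "\<And>x. x \<in> convex hull C \<Longrightarrow> n \<bullet> x > b"
    using separating_hyperplane_closed_point[of "convex hull C" q] q by auto
  have pos: "n \<bullet> (x - q) > 0" if "x \<in> C" for x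
    using n(1) n(2)[of x] that by (simp add: inner_diff_right hull_inc)
  \<comment> \<open>The tangent of the angle from \<open>n\<close> to \<open>x - q\<close>, which is
    strictly increasing in the angle because \<open>n\<close> has a positive inner product with
    \<open>x - q\<close>.\<close>
  define key where "key x = orient q (q + n) x / (n \<bullet> (x - q))" for x
  have key: "orient q x y > 0 \<longleftrightarrow> key x < key y" if "x \<in> C" "y \<in> C" for x y
  proof -
    have nn: "n \<bullet> n > 0" using pos[OF that(1)] by auto
    have "(n \<bullet> n) * orient q x y = (n \<bullet> (x - q)) * orient q (q + n) y - orient q (q + n) x * (n \<bullet> (y - q))"
      by (simp add: orient_def inner_vec_def sum_2 algebra_simps)
    moreover have "orient q x y > 0 \<longleftrightarrow> (n \<bullet> n) * orient q x y > 0"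
      using nn by (metis mult_pos_pos zero_less_mult_pos)
    moreover have "key x < key y \<longleftrightarrow>
        orient q (q + n) x * (n \<bullet> (y - q)) < (n \<bullet> (x - q)) * orient q (q + n) y"
      using pos[OF that(1)] pos[OF that(2)] by (simp add: key_def field_simps)
    ultimately show ?thesis by linarith
  qed
  have inj: "inj_on key C"
  proof (rule inj_onI, rule ccontr)
    fix x y assume h: "x \<in> C" "y \<in> C" "key x = key y" "x \<noteq> y"
    then have "orient q x y \<noteq> 0" using gp by blast
    moreover have "\<not> orient q x y > 0" "\<not> orient q y x > 0" using key h by auto
    moreover have "orient q y x = - orient q x y" by (rule orient_swap')
    ultimately show False by linarith
  qed
  define ks where "ks = sorted_list_of_set (key ` C)"
  define us where "us = map (inv_into C key) ks"
  have sks: "set ks = key ` C" "distinct ks" "sorted_wrt (<) ks"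
    using fin by (auto simp: ks_def)
  have su: "set us = C" using inj by (simp add: us_def sks)
  have kk: "key (us!i) = ks!i" if "i < length us" for i
    using that f_inv_into_f[of "ks!i" key C] sks(1) nth_mem[of i ks] by (simp add: us_def)
  have "distinct us"
    using sks by (simp add: us_def distinct_map inj_on_inv_into)
  moreover have "orient q (us!i) (us!j) > 0" if "i < j" "j < length us" for i j
  proof -
    have "ks!i < ks!j" using sks(3) that by (auto simp: us_def sorted_wrt_iff_nth_less)
    then have "key (us!i) < key (us!j)" using kk that by simp
    then show ?thesis using key su that nth_mem by (metis order.strict_trans)
  qed
  ultimately show ?thesis using su that by blast
qed

section \<open>Facing chains\<close>

lemma convex_comb_in_segment: "0 \<le> k \<Longrightarrow> k \<le> 1 \<Longrightarrow> (1 - k) *\<^sub>R x + k *\<^sub>R y \<in> closed_segment x y"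
  by (auto simp: in_segment)

lemma convex_comb_eq_start:
  fixes x y :: "'a::real_vector"
  assumes "(1 - k) *\<^sub>R x + k *\<^sub>R y = x" "k \<noteq> 0"
  shows "y = x"
proof -
  have "k *\<^sub>R (y - x) = ((1 - k) *\<^sub>R x + k *\<^sub>R y) - x" by (simp add: algebra_simps)
  then show ?thesis using assms by simp
qed

text \<open>Unlike in \<open>double_chain\<close>, a chain may be empty; this makes the notion
  stable under the removal of points, as the induction requires.\<close>

definition facing_chains :: "(real^2) set \<Rightarrow> (real^2) set \<Rightarrow> bool" where
  "facing_chains C1 C2 \<longleftrightarrow> finite C1 \<and> finite C2 \<and> C1 \<inter> C2 = {} \<and> general_position (C1 \<union> C2) \<and>
     convex_position C1 \<and> convex_position C2 \<and>
     (\<forall>p\<in>C1. \<forall>q\<in>C2. closed_segment p q \<inter> convex hull C1 = {p} \<and>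
        closed_segment p q \<inter> convex hull C2 = {q})"

lemma facing_chains_sym: "facing_chains C1 C2 \<Longrightarrow> facing_chains C2 C1"
  unfolding facing_chains_def by (metis Int_commute Un_commute closed_segment_commute)

lemma convex_position_subset: "convex_position C \<Longrightarrow> D \<subseteq> C \<Longrightarrow> convex_position D"
  unfolding convex_position_def by (meson Diff_mono hull_mono order_refl subset_eq)

lemma facing_chains_subset:
  assumes "facing_chains C1 C2" "D1 \<subseteq> C1" "D2 \<subseteq> C2"
  shows "facing_chains D1 D2"
proof -
  have "closed_segment p q \<inter> convex hull D1 = {p} \<and> closed_segment p q \<inter> convex hull D2 = {q}"
    if "p \<in> D1" "q \<in> D2" for p q
  proof -
    have "closed_segment p q \<inter> convex hull C1 = {p}" "closed_segment p q \<inter> convex hull C2 = {q}"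
      using assms that unfolding facing_chains_def by blast+
    moreover have "p \<in> convex hull D1" "q \<in> convex hull D2" using that by (auto simp: hull_inc)
    moreover have "convex hull D1 \<subseteq> convex hull C1" "convex hull D2 \<subseteq> convex hull C2"
      using hull_mono[OF assms(2)] hull_mono[OF assms(3)] by blast+
    ultimately show ?thesis by auto
  qed
  moreover have "general_position (D1 \<union> D2)"
    using assms unfolding facing_chains_def general_position_def by (meson Un_mono subset_eq)
  ultimately show ?thesis
    using assms unfolding facing_chains_def
    by (meson convex_position_subset disjoint_iff finite_subset subset_eq)
qed

lemma facing_chains_orient:
  assumes "facing_chains C1 C2" "a \<in> C1 \<union> C2" "b \<in> C1 \<union> C2" "c \<in> C1 \<union> C2" "a \<noteq> b" "a \<noteq> c" "b \<noteq> c"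
  shows "orient a b c \<noteq> 0"
  using general_position_orient assms unfolding facing_chains_def by blast

lemma facing_chains_endpoint:
  assumes "facing_chains C1 C2" "p \<in> C1" "q \<in> C2" "z \<in> closed_segment p q" "z \<in> convex hull C1"
  shows "z = p"
  using assms unfolding facing_chains_def by blast

lemma facing_chains_not_in_hull:
  assumes "facing_chains C1 C2" "q \<in> C2"
  shows "q \<notin> convex hull C1"
proof
  assume q: "q \<in> convex hull C1"
  then have "C1 \<noteq> {}" by auto
  then obtain p where p: "p \<in> C1" by blast
  have "q = p" using facing_chains_endpoint[OF assms(1) p assms(2) _ q] by simp
  then show False using assms p unfolding facing_chains_def by blast
qed

lemma facing_chains_neq: "facing_chains C1 C2 \<Longrightarrow> p \<in> C1 \<Longrightarrow> q \<in> C2 \<Longrightarrow> p \<noteq> q"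
  unfolding facing_chains_def by blast

text \<open>A chain bulges towards every point \<open>q\<close> of the other one: if
  \<open>y\<close> were beyond the chord \<open>xz\<close>, the segment from \<open>q\<close> to
  \<open>y\<close> would meet the hull of \<open>C1\<close> on this chord before reaching
  \<open>y\<close>.\<close>

lemma facing_chains_visible:
  assumes F: "facing_chains C1 C2" and q: "q \<in> C2"
    and x: "x \<in> C1" "y \<in> C1" "z \<in> C1"
    and o: "orient q x y > 0" "orient q y z > 0" "orient q x z > 0"
  shows "orient x y z < 0"
proof (rule ccontr)
  assume n: "\<not> orient x y z < 0"
  have "x \<noteq> y" "y \<noteq> z" "x \<noteq> z" using o by auto
  then have "orient x y z \<noteq> 0" using facing_chains_orient[OF F] x by blast
  then have pos: "orient x y z > 0" using n by linarith
  \<comment> \<open>\<open>D\<close> is twice the area of the quadrilateral \<open>q x y z\<close>;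
    \<open>u\<close> and \<open>v\<close> are the parameters of the crossing point of its diagonals
    \<open>qy\<close> and \<open>xz\<close>.\<close>
  define D where "D = orient q x y + orient q y z"
  have D: "D > 0" using o D_def by simp
  have lt: "orient q x z < D" using pos by (simp add: D_def orient_def algebra_simps)
  define u where "u = orient q x z / D"
  define v where "v = orient q x y / D"
  have u: "0 \<le> u" "u < 1" and v: "0 \<le> v" "v \<le> 1"
    using o D lt by (auto simp: u_def v_def D_def)
  have uD: "u * D = orient q x z" and vD: "v * D = orient q x y"
    using D by (auto simp: u_def v_def)
  have comp: "(1 - u) * q$i + u * y$i = (1 - v) * x$i + v * z$i" if "i = 1 \<or> i = 2" for i
  proof -
    have "D * ((1 - u) * q$i + u * y$i) = (D - u * D) * q$i + (u * D) * y$i"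
      by (simp add: algebra_simps)
    also have "\<dots> = (D - v * D) * x$i + (v * D) * z$i"
      unfolding uD vD unfolding D_def orient_def using that by (auto simp: algebra_simps)
    also have "\<dots> = D * ((1 - v) * x$i + v * z$i)" by (simp add: algebra_simps)
    finally show ?thesis using D by simp
  qed
  have e: "(1 - u) *\<^sub>R q + u *\<^sub>R y = (1 - v) *\<^sub>R x + v *\<^sub>R z"
    using comp by (simp add: vec_eq_iff forall_2)
  let ?w = "(1 - u) *\<^sub>R q + u *\<^sub>R y"
  have "?w \<in> closed_segment y q"
    using u unfolding closed_segment_commute[of y q] by (auto simp: in_segment)
  moreover have "?w \<in> closed_segment x z" unfolding e using v by (auto simp: in_segment)
  then have "?w \<in> convex hull C1"
    using segment_subset_hull[of x C1 z] x by blast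
  ultimately have "?w = y" using facing_chains_endpoint[OF F x(2) q] by blast
  then have "(1 - u) *\<^sub>R (q - y) = 0" by (simp add: algebra_simps)
  then have "q = y" using u by simp
  then show False using o by simp
qed

text \<open>The segment \<open>xy\<close> meets the hull of \<open>C1\<close> only in
  \<open>x\<close>, and convex position keeps \<open>x\<close> out of the hull of the other
  points.\<close>

lemma facing_chains_chord_disjoint:
  assumes F: "facing_chains C1 C2" and "x \<in> C1" "y \<in> C2" "a \<in> C1" "b \<in> C1" "x \<noteq> a" "x \<noteq> b"
  shows "closed_segment x y \<inter> closed_segment a b = {}"
proof (rule ccontr)
  assume "\<not> ?thesis"
  then obtain z where z: "z \<in> closed_segment x y" "z \<in> closed_segment a b" by blast
  then have "z \<in> convex hull C1" using segment_subset_hull assms by blast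
  then have "z = x" using facing_chains_endpoint[OF F assms(2,3) z(1)] by blast
  moreover have "closed_segment a b \<subseteq> convex hull (C1 - {x})"
    using segment_subset_hull[of a "C1 - {x}" b] assms by blast
  ultimately have "x \<in> convex hull (C1 - {x})" using z by blast
  then show False using assms unfolding facing_chains_def convex_position_def by blast
qed

text \<open>Affine coordinates at the crossing point \<open>z\<close> of the chords from
  \<open>a = z - A p\<close> to \<open>b = z + p\<close> and from \<open>c = z - C q\<close> to
  \<open>d = z + q\<close>. The third point \<open>e = z + s p + t q\<close> lies in the angle
  between \<open>b\<close> and \<open>d\<close>. The segment \<open>ec\<close> forces
  \<open>s > 1\<close>, and \<open>d\<close> being outside \<open>K\<close> forces
  \<open>t A < A + s\<close>; then \<open>ae\<close> crosses \<open>bd\<close> in a point of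
  \<open>K\<close> other than \<open>b\<close>.\<close>

lemma crossing_chords_third_point:
  fixes z p q :: "'a::real_vector"
  assumes pos: "A > 0" "C > 0" "s > 0" "t > 0" and K: "convex K"
    and mem: "z - A *\<^sub>R p \<in> K" "z + p \<in> K" "z + s *\<^sub>R p + t *\<^sub>R q \<in> K"
    and c: "closed_segment (z + s *\<^sub>R p + t *\<^sub>R q) (z - C *\<^sub>R q) \<inter> K \<subseteq> {z + s *\<^sub>R p + t *\<^sub>R q}"
    and d: "closed_segment (z + p) (z + q) \<inter> K \<subseteq> {z + p}"
    and dK: "z + q \<notin> K"
    and ne: "z - C *\<^sub>R q \<noteq> z + s *\<^sub>R p + t *\<^sub>R q"
  shows False
proof -
  let ?a = "z - A *\<^sub>R p" and ?b = "z + p" and ?e = "z + s *\<^sub>R p + t *\<^sub>R q"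
  have comb: "(1 - k) *\<^sub>R x + k *\<^sub>R y \<in> K" if "x \<in> K" "y \<in> K" "0 \<le> k" "k \<le> 1" for x y k
    using K that by (simp add: convex_alt)
  have line: "z + k *\<^sub>R p \<in> K" if "- A \<le> k" "k \<le> 1" for k
  proof -
    define l where "l = (k + A) / (1 + A)"
    have l: "0 \<le> l" "l \<le> 1" and lA: "l * (1 + A) = k + A" using that pos by (auto simp: l_def divide_simps)
    have "(1 - l) *\<^sub>R ?a + l *\<^sub>R ?b = z + (l * (1 + A) - A) *\<^sub>R p" by (simp add: algebra_simps)
    then show ?thesis using comb[OF mem(1,2) l] lA by simp
  qed
  have s1: "s > 1"
  proof (rule ccontr)
    assume "\<not> s > 1"
    \<comment> \<open>Here the segment from \<open>e\<close> to \<open>c\<close> has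
      \<open>q\<close>-coordinate 0, and if \<open>s\<close> is at most 1, this point is on the
      chord \<open>ab\<close>.\<close>
    define k where "k = t / (C + t)"
    have k: "0 < k" "k \<le> 1" and kC: "k * (C + t) = t" using pos by (auto simp: k_def divide_simps)
    have e: "(1 - k) *\<^sub>R ?e + k *\<^sub>R (z - C *\<^sub>R q) = z + ((1 - k) * s) *\<^sub>R p + (t - k * (C + t)) *\<^sub>R q"
      by (simp add: algebra_simps)
    have "(1 - k) * s \<le> 1" using k \<open>\<not> s > 1\<close> pos by (intro mult_le_one) auto
    moreover have "- A \<le> (1 - k) * s" using k pos by (smt (verit) mult_nonneg_nonneg)
    ultimately have "(1 - k) *\<^sub>R ?e + k *\<^sub>R (z - C *\<^sub>R q) \<in> K" using line kC e by simp
    moreover have "(1 - k) *\<^sub>R ?e + k *\<^sub>R (z - C *\<^sub>R q) \<in> closed_segment ?e (z - C *\<^sub>R q)"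
      using k by (intro convex_comb_in_segment) auto
    ultimately have "(1 - k) *\<^sub>R ?e + k *\<^sub>R (z - C *\<^sub>R q) = ?e" using c by blast
    then have "z - C *\<^sub>R q = ?e" by (rule convex_comb_eq_start) (use k in simp)
    then show False using ne by simp
  qed
  have tA: "t * A < A + s"
  proof (rule ccontr)
    assume n: "\<not> t * A < A + s"
    \<comment> \<open>Here the segment \<open>ae\<close> has \<open>p\<close>-coordinate 0; its
      \<open>q\<close>-coordinate \<open>k * t\<close> is at least 1, so \<open>d\<close> lies
      between this point and \<open>z\<close>.\<close>
    define k where "k = A / (A + s)"
    have k: "0 \<le> k" "k \<le> 1" and kA: "k * (A + s) = A" using pos by (auto simp: k_def divide_simps)
    have "(1 - k) *\<^sub>R ?a + k *\<^sub>R ?e = z + (k * (A + s) - A) *\<^sub>R p + (k * t) *\<^sub>R q"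
      by (simp add: algebra_simps)
    then have "z + (k * t) *\<^sub>R q \<in> K" using comb[OF mem(1,3) k] kA by simp
    have kt: "k * t \<ge> 1" using n pos by (simp add: k_def divide_simps mult.commute)
    have "z \<in> K" using line[of 0] pos by simp
    then have "(1 - 1 / (k * t)) *\<^sub>R z + (1 / (k * t)) *\<^sub>R (z + (k * t) *\<^sub>R q) \<in> K"
      using comb \<open>z + (k * t) *\<^sub>R q \<in> K\<close> kt by simp
    moreover have "k \<noteq> 0" "t \<noteq> 0" using kt by auto
    ultimately have "z + q \<in> K" by (simp add: algebra_simps)
    then show False using dK by simp
  qed
  define D where "D = t + s + A"
  have D: "D > 0" using pos D_def by simp
  \<comment> \<open>The solution of \<open>(1 - m) a + m e = (1 - l) b + l d\<close>. The bounds on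
    \<open>s\<close> and \<open>t\<close> put \<open>m\<close> and \<open>l\<close> into the unit
    interval.\<close>
  define m l where ml: "m = (1 + A) / D" "l = (t + t * A) / D"
  have mD: "m * D = 1 + A" and lD: "l * D = t + t * A" using D by (auto simp: ml)
  have m: "0 \<le> m" "m \<le> 1" using pos s1 D by (auto simp: ml D_def)
  have l: "0 < l" "l \<le> 1" using pos tA D by (auto simp: ml D_def add_pos_pos)
  have i1: "m * t = l" by (simp add: ml algebra_simps)
  have i2: "m * (A + s) - A = 1 - l"
  proof -
    have "D * (m * (A + s) - A) = (m * D) * (A + s) - A * D" by (simp add: algebra_simps)
    also have "\<dots> = D - l * D" unfolding mD lD by (simp add: D_def algebra_simps)
    also have "\<dots> = D * (1 - l)" by (simp add: algebra_simps)
    finally show ?thesis using D by simp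
  qed
  have "(1 - m) *\<^sub>R ?a + m *\<^sub>R ?e = z + (m * (A + s) - A) *\<^sub>R p + (m * t) *\<^sub>R q"
    by (simp add: algebra_simps)
  also have "\<dots> = (1 - l) *\<^sub>R ?b + l *\<^sub>R (z + q)" unfolding i1 i2 by (simp add: algebra_simps)
  finally have "(1 - l) *\<^sub>R ?b + l *\<^sub>R (z + q) \<in> K" using comb[OF mem(1,3) m] by simp
  moreover have "(1 - l) *\<^sub>R ?b + l *\<^sub>R (z + q) \<in> closed_segment ?b (z + q)"
    using l by (intro convex_comb_in_segment) auto
  ultimately have "(1 - l) *\<^sub>R ?b + l *\<^sub>R (z + q) = ?b" using d by blast
  then have "z + q = ?b" by (rule convex_comb_eq_start) (use l in simp)
  then show False using dK mem(2) by simp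
qed

text \<open>A crossing of the chords is contradictory because of the third point \<open>e\<close>:
  exchanging \<open>a\<close> with \<open>b\<close> or \<open>c\<close> with \<open>d\<close> moves
  \<open>e\<close> into the angle between \<open>b\<close> and \<open>d\<close>, where
  \<open>crossing_chords_third_point\<close> applies.\<close>

lemma facing_chains_chords_disjoint_aux:
  assumes F: "facing_chains C1 C2" and ab: "a \<in> C1" "b \<in> C1" and cd: "c \<in> C2" "d \<in> C2"
    and e: "e \<in> C1" "e \<noteq> a" "e \<noteq> b"
  shows "closed_segment a b \<inter> closed_segment c d = {}"
proof (rule ccontr)
  assume "\<not> ?thesis"
  then obtain z where z: "z \<in> closed_segment a b" "z \<in> closed_segment c d" by blast
  have zh: "z \<in> convex hull C1" "z \<in> convex hull C2"
    using z segment_subset_hull ab cd by blast+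
  have nz: "z \<noteq> x" if "x \<in> C1 \<union> C2" for x
    using zh that facing_chains_not_in_hull[OF F] facing_chains_not_in_hull[OF facing_chains_sym[OF F]] by blast
  obtain \<alpha> where \<alpha>: "0 \<le> \<alpha>" "\<alpha> \<le> 1" "z = (1 - \<alpha>) *\<^sub>R a + \<alpha> *\<^sub>R b" using z(1) by (auto simp: in_segment)
  obtain \<gamma> where \<gamma>: "0 \<le> \<gamma>" "\<gamma> \<le> 1" "z = (1 - \<gamma>) *\<^sub>R c + \<gamma> *\<^sub>R d" using z(2) by (auto simp: in_segment)
  have "z \<noteq> a" "z \<noteq> b" "z \<noteq> c" "z \<noteq> d" using nz ab cd by blast+
  then have "\<alpha> \<noteq> 0" "\<alpha> \<noteq> 1" "\<gamma> \<noteq> 0" "\<gamma> \<noteq> 1" using \<alpha>(3) \<gamma>(3) by auto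
  then have \<alpha>': "0 < \<alpha>" "\<alpha> < 1" and \<gamma>': "0 < \<gamma>" "\<gamma> < 1" using \<alpha> \<gamma> by auto
  have ea: "(1 - \<alpha>) *\<^sub>R (a - z) = - \<alpha> *\<^sub>R (b - z)" using \<alpha>(3) by (simp add: algebra_simps)
  have ec: "(1 - \<gamma>) *\<^sub>R (c - z) = - \<gamma> *\<^sub>R (d - z)" using \<gamma>(3) by (simp add: algebra_simps)
  define A where "A = \<alpha> / (1 - \<alpha>)"
  define C where "C = \<gamma> / (1 - \<gamma>)"
  have AC: "A > 0" "C > 0" using \<alpha>' \<gamma>' by (auto simp: A_def C_def)
  have solve: "x = (- (k / (1 - k))) *\<^sub>R y" if "(1 - k) *\<^sub>R x = - k *\<^sub>R y" "k < 1" for k and x y :: "real^2"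
  proof -
    have "inverse (1 - k) *\<^sub>R ((1 - k) *\<^sub>R x) = inverse (1 - k) *\<^sub>R (- k *\<^sub>R y)" using that by simp
    then show ?thesis using that(2) by (simp add: divide_inverse mult.commute)
  qed
  have a: "a - z = - A *\<^sub>R (b - z)" unfolding A_def by (rule solve[OF ea \<alpha>'(2)])
  have c: "c - z = - C *\<^sub>R (d - z)" unfolding C_def by (rule solve[OF ec \<gamma>'(2)])
  have distinct: "a \<noteq> b" "c \<noteq> d" "e \<noteq> c" "e \<noteq> d" "a \<noteq> c" "b \<noteq> c" "a \<noteq> d" "b \<noteq> d"
    using z nz ab cd e facing_chains_neq[OF F] by auto
  define p q r where pqr: "p = b - z" "q = d - z" "r = e - z"
  define br where "br x y = x$1 * y$2 - x$2 * y$1" for x y :: "real^2"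
  have "orient z b d = br p q" "orient z b e = br p r" "orient z e d = br r q"
    by (auto simp: br_def pqr orient_def)
  have "orient a b d = (1 + A) * br p q"
  proof -
    have eqs: "a$i = z$i - A * p$i" "b$i = z$i + p$i" "d$i = z$i + q$i" for i
      using a by (auto simp: pqr vec_eq_iff algebra_simps)
    show ?thesis unfolding orient_def br_def eqs by (simp add: algebra_simps)
  qed
  moreover have "orient a b e = (1 + A) * br p r"
  proof -
    have eqs: "a$i = z$i - A * p$i" "b$i = z$i + p$i" "e$i = z$i + r$i" for i
      using a by (auto simp: pqr vec_eq_iff algebra_simps)
    show ?thesis unfolding orient_def br_def eqs by (simp add: algebra_simps)
  qed
  moreover have "orient c d e = (1 + C) * br q r"
  proof -
    have eqs: "c$i = z$i - C * q$i" "d$i = z$i + q$i" "e$i = z$i + r$i" for i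
      using c by (auto simp: pqr vec_eq_iff algebra_simps)
    show ?thesis unfolding orient_def br_def eqs by (simp add: algebra_simps)
  qed
  moreover have "orient a b d \<noteq> 0" "orient a b e \<noteq> 0" "orient c d e \<noteq> 0"
    using facing_chains_orient[OF F] ab cd e distinct by blast+
  ultimately have nzb: "br p q \<noteq> 0" "br p r \<noteq> 0" "br q r \<noteq> 0" by auto
  \<comment> \<open>Cramer's rule for the coordinates of \<open>r\<close> with respect to
    \<open>p\<close> and \<open>q\<close>; general position makes both nonzero.\<close>
  define s t where st: "s = br r q / br p q" "t = br p r / br p q"
  have brr: "br r q = - br q r" by (simp add: br_def)
  have st0: "s \<noteq> 0" "t \<noteq> 0" using nzb by (auto simp: st brr)
  have "br p q *\<^sub>R r = br r q *\<^sub>R p + br p r *\<^sub>R q"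
    by (auto simp: vec_eq_iff forall_2 br_def algebra_simps)
  then have "inverse (br p q) *\<^sub>R (br p q *\<^sub>R r) = inverse (br p q) *\<^sub>R (br r q *\<^sub>R p + br p r *\<^sub>R q)" by simp
  then have r: "r = s *\<^sub>R p + t *\<^sub>R q"
    using nzb by (simp add: st divide_inverse scaleR_add_right mult.commute)
  have K: "convex (convex hull C1)" by simp
  have *: False
    if h: "a' \<in> C1" "b' \<in> C1" "c' \<in> C2" "d' \<in> C2" "A' > 0" "C' > 0" "s' > 0" "t' > 0"
      "a' - z = - A' *\<^sub>R (b' - z)" "c' - z = - C' *\<^sub>R (d' - z)" "r = s' *\<^sub>R (b' - z) + t' *\<^sub>R (d' - z)"
    for a' b' c' d' A' C' s' t'
  proof (rule crossing_chords_third_point[OF h(5-8) K, of z "b' - z" "d' - z"])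
    have eqs: "z - A' *\<^sub>R (b' - z) = a'" "z + (b' - z) = b'" "z + (d' - z) = d'" "z - C' *\<^sub>R (d' - z) = c'"
      using h(9,10) by (auto simp: algebra_simps)
    have ee: "z + s' *\<^sub>R (b' - z) + t' *\<^sub>R (d' - z) = e"
      using h(11) by (simp add: pqr algebra_simps)
    show "z - A' *\<^sub>R (b' - z) \<in> convex hull C1" "z + (b' - z) \<in> convex hull C1"
      "z + s' *\<^sub>R (b' - z) + t' *\<^sub>R (d' - z) \<in> convex hull C1"
      unfolding eqs ee using h e by (auto simp: hull_inc)
    show "closed_segment (z + s' *\<^sub>R (b' - z) + t' *\<^sub>R (d' - z)) (z - C' *\<^sub>R (d' - z)) \<inter> convex hull C1
        \<subseteq> {z + s' *\<^sub>R (b' - z) + t' *\<^sub>R (d' - z)}"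
      unfolding eqs ee using facing_chains_endpoint[OF F e(1) h(3)] by blast
    show "closed_segment (z + (b' - z)) (z + (d' - z)) \<inter> convex hull C1 \<subseteq> {z + (b' - z)}"
      unfolding eqs using facing_chains_endpoint[OF F h(2,4)] by blast
    show "z + (d' - z) \<notin> convex hull C1"
      unfolding eqs using facing_chains_not_in_hull[OF F h(4)] .
    show "z - C' *\<^sub>R (d' - z) \<noteq> z + s' *\<^sub>R (b' - z) + t' *\<^sub>R (d' - z)"
      unfolding eqs ee using facing_chains_neq[OF F e(1) h(3)] by auto
  qed
  \<comment> \<open>Exchanging \<open>a\<close> and \<open>b\<close> turns \<open>A\<close> into
    \<open>1 / A\<close> and the coordinate \<open>s\<close> into \<open>- s / A\<close>; likewise
    for \<open>c\<close>, \<open>d\<close>, \<open>C\<close> and \<open>t\<close>.\<close>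
  have a': "b - z = - (1 / A) *\<^sub>R (a - z)" "s *\<^sub>R (b - z) = (- s / A) *\<^sub>R (a - z)"
    unfolding a using AC by simp_all
  have c': "d - z = - (1 / C) *\<^sub>R (c - z)" "t *\<^sub>R (d - z) = (- t / C) *\<^sub>R (c - z)"
    unfolding c using AC by simp_all
  have r': "r = s *\<^sub>R (b - z) + t *\<^sub>R (d - z)" using r by (simp add: pqr)
  have AC': "1 / A > 0" "1 / C > 0" using AC by auto
  consider "s > 0" "t > 0" | "s < 0" "t > 0" | "s > 0" "t < 0" | "s < 0" "t < 0"
    using st0 by linarith
  then show False
  proof cases
    case 1
    show False by (rule *[OF ab cd AC 1 a c r'])
  next
    case 2
    have "- s / A > 0" using AC 2 by (simp add: divide_neg_pos)
    then show False
      using *[OF ab(2) ab(1) cd AC'(1) AC(2) _ 2(2) a'(1) c] r' unfolding a'(2) by blast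
  next
    case 3
    have "- t / C > 0" using AC 3 by (simp add: divide_neg_pos)
    then show False
      using *[OF ab cd(2) cd(1) AC(1) AC'(2) 3(1) _ a c'(1)] r' unfolding c'(2) by blast
  next
    case 4
    have "- t / C > 0" "- s / A > 0" using AC 4 by (auto simp: divide_neg_pos)
    then show False
      using *[OF ab(2) ab(1) cd(2) cd(1) AC' _ _ a'(1) c'(1)] r' unfolding c'(2) a'(2) by blast
  qed
qed

text \<open>The bound 5 supplies a point besides the four end points. It is sharp: the two diagonals
  of a convex quadrilateral are facing chains that cross.\<close>

lemma facing_chains_chords_disjoint:
  assumes F: "facing_chains C1 C2" and n: "card (C1 \<union> C2) \<ge> 5"
    and ab: "a \<in> C1" "b \<in> C1" and cd: "c \<in> C2" "d \<in> C2"
  shows "closed_segment a b \<inter> closed_segment c d = {}"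
proof -
  have "\<not> C1 \<union> C2 \<subseteq> {a, b, c, d}"
  proof
    assume "C1 \<union> C2 \<subseteq> {a, b, c, d}"
    then have "card (C1 \<union> C2) \<le> card {a, b, c, d}" by (intro card_mono) auto
    also have "\<dots> \<le> 4" by (simp add: card_insert_if)
    finally show False using n by simp
  qed
  then obtain e where e: "e \<in> C1 \<union> C2" "e \<noteq> a" "e \<noteq> b" "e \<noteq> c" "e \<noteq> d" by blast
  show ?thesis
  proof (cases "e \<in> C1")
    case True
    then show ?thesis using facing_chains_chords_disjoint_aux[OF F ab cd] e by blast
  next
    case False
    then have "closed_segment c d \<inter> closed_segment a b = {}"
      using facing_chains_chords_disjoint_aux[OF facing_chains_sym[OF F] cd ab] e by blast
    then show ?thesis by blast
  qed
qed

section \<open>Hull edges and convex position\<close>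

lemma halfplane_hull:
  assumes "\<And>x. x \<in> Y \<Longrightarrow> orient a b x > 0"
  shows "x \<in> convex hull Y \<Longrightarrow> orient a b x > 0"
proof -
  have "convex {x. orient a b x > 0}"
    unfolding convex_alt by (auto simp: orient_convex_comb)
      (smt (verit) mult_nonneg_nonneg mult_pos_pos)
  then have "convex hull Y \<subseteq> {x. orient a b x > 0}"
    by (intro hull_minimal) (use assms in auto)
  then show "x \<in> convex hull Y \<Longrightarrow> orient a b x > 0" by blast
qed

text \<open>A point of maximal norm is extreme, and the angularly first of the other points as seen
  from it completes a hull edge.\<close>

lemma hull_edge_exists:
  fixes X :: "(real^2) set"
  assumes fin: "finite X" and n: "card X \<ge> 2" and gp: "general_position X"
  obtains a b where "a \<in> X" "b \<in> X" "a \<noteq> b" "\<And>x. x \<in> X - {a, b} \<Longrightarrow> orient a b x > 0"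
proof -
  have "X \<noteq> {}" using n by auto
  then have "Max (norm ` X) \<in> norm ` X" using fin by (intro Max_in) auto
  then obtain a where a: "a \<in> X" "norm a = Max (norm ` X)" by auto
  have mx: "norm x \<le> norm a" if "x \<in> X" for x using that fin a(2) by simp
  have lt: "a \<bullet> x < a \<bullet> a" if "x \<in> X" "x \<noteq> a" for x
  proof -
    have "(a - x) \<bullet> (a - x) > 0" using that by simp
    then have "2 * (a \<bullet> x) < a \<bullet> a + x \<bullet> x" by (simp add: inner_diff inner_commute)
    moreover have "x \<bullet> x \<le> a \<bullet> a" using mx[OF that(1)] by (simp add: norm_le)
    ultimately show ?thesis by linarith
  qed
  have "convex hull (X - {a}) \<subseteq> {x. a \<bullet> x < a \<bullet> a}"
    by (intro hull_minimal) (use lt in \<open>auto simp: convex_halfspace_lt\<close>)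
  then have "a \<notin> convex hull (X - {a})" by blast
  then obtain us where us: "distinct us" "set us = X - {a}"
    "\<And>i j. i < j \<Longrightarrow> j < length us \<Longrightarrow> orient a (us!i) (us!j) > 0"
    using angular_sort[of "X - {a}" a] fin general_position_orient[OF gp a(1)] by (metis DiffE finite_Diff insertCI)
  have "card (X - {a}) \<ge> 1" using n a fin by simp
  then have l: "0 < length us" using distinct_card[OF us(1)] unfolding us(2) by linarith
  show ?thesis
  proof (rule that[of a "us!0"])
    show "a \<in> X" "us!0 \<in> X" "a \<noteq> us!0" using a us(2) nth_mem[OF l] by auto
    show "orient a (us!0) x > 0" if x: "x \<in> X - {a, us!0}" for x
    proof -
      have "x \<in> set us" using x us(2) by blast
      then obtain j where "j < length us" "x = us!j" by (metis in_set_conv_nth)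
      moreover then have "j \<noteq> 0" using x by (intro notI) auto
      ultimately show ?thesis using us(3)[of 0 j] by simp
    qed
  qed
qed

text \<open>The edges after and before \<open>ab\<close>: \<open>c\<close> is the angularly first
  point around \<open>b\<close> and \<open>d\<close> the last one around \<open>a\<close>. They
  coincide if the hull is a triangle.\<close>

lemma hull_edge_neighbours:
  fixes X :: "(real^2) set"
  assumes fin: "finite X" and n: "card X \<ge> 3" and gp: "general_position X"
    and ab: "a \<in> X" "b \<in> X" "a \<noteq> b" and e: "\<And>x. x \<in> X - {a, b} \<Longrightarrow> orient a b x > 0"
  obtains c d where "c \<in> X - {a, b}" "d \<in> X - {a, b}"
    "\<And>x. x \<in> X - {b, c} \<Longrightarrow> orient b c x > 0" "\<And>x. x \<in> X - {d, a} \<Longrightarrow> orient d a x > 0"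
proof -
  let ?Y = "X - {a, b}"
  have h: "a \<notin> convex hull ?Y" "b \<notin> convex hull ?Y"
    using halfplane_hull[of ?Y a b, OF e] by (metis less_irrefl orient_triv(2), metis less_irrefl orient_triv(3))
  obtain us where us: "distinct us" "set us = ?Y"
    "\<And>i j. i < j \<Longrightarrow> j < length us \<Longrightarrow> orient b (us!i) (us!j) > 0"
    using angular_sort[of ?Y b, OF _ h(2)] fin general_position_orient[OF gp ab(2)]
    by (metis DiffE finite_Diff insertCI)
  obtain vs where vs: "distinct vs" "set vs = ?Y"
    "\<And>i j. i < j \<Longrightarrow> j < length vs \<Longrightarrow> orient a (vs!i) (vs!j) > 0"
    using angular_sort[of ?Y a, OF _ h(1)] fin general_position_orient[OF gp ab(1)]
    by (metis DiffE finite_Diff insertCI)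
  have "card ?Y \<ge> 1" using n ab fin by (simp add: card_Diff_subset)
  then have l: "0 < length us" "0 < length vs"
    using distinct_card[OF us(1)] distinct_card[OF vs(1)] unfolding us(2) vs(2) by linarith+
  define c where "c = us!0"
  define d where "d = vs!(length vs - 1)"
  have c: "c \<in> ?Y" and d: "d \<in> ?Y"
    using nth_mem[OF l(1)] nth_mem[of "length vs - 1" vs] l us vs by (auto simp: c_def d_def)
  show ?thesis
  proof (rule that[OF c d])
    show "orient b c x > 0" if x: "x \<in> X - {b, c}" for x
    proof (cases "x = a")
      case True
      then show ?thesis using e[OF c] orient_rotate[of a b c] by simp
    next
      case False
      then have "x \<in> set us" using x us(2) by blast
      then obtain j where j: "j < length us" "x = us!j" by (metis in_set_conv_nth)
      then have "j \<noteq> 0" using x by (intro notI) (auto simp: c_def)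
      then show ?thesis using us(3)[of 0 j] j by (simp add: c_def)
    qed
    show "orient d a x > 0" if x: "x \<in> X - {d, a}" for x
    proof (cases "x = b")
      case True
      then show ?thesis using e[OF d] orient_rotate[of d a b] by simp
    next
      case False
      then have "x \<in> set vs" using x vs(2) by blast
      then obtain j where j: "j < length vs" "x = vs!j" by (metis in_set_conv_nth)
      then have "j \<noteq> length vs - 1" using x by (intro notI) (auto simp: d_def)
      then show ?thesis using vs(3)[of j "length vs - 1"] j orient_rotate[of d a x] by (simp add: d_def)
    qed
  qed
qed

text \<open>If no hull edge stayed within one chain, the hull vertices would alternate between the chains
  and two chords would cross.\<close>

lemma monochain_hull_edge:
  assumes F: "facing_chains C1 C2" and n: "card (C1 \<union> C2) \<ge> 5"
  obtains a b where "a \<noteq> b" "(a \<in> C1 \<and> b \<in> C1) \<or> (a \<in> C2 \<and> b \<in> C2)"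
    "\<And>x. x \<in> C1 \<union> C2 - {a, b} \<Longrightarrow> orient a b x > 0"
proof -
  let ?X = "C1 \<union> C2"
  have fin: "finite ?X" and gp: "general_position ?X" using F unfolding facing_chains_def by auto
  obtain a b where ab: "a \<in> ?X" "b \<in> ?X" "a \<noteq> b" "\<And>x. x \<in> ?X - {a, b} \<Longrightarrow> orient a b x > 0"
    using hull_edge_exists[OF fin _ gp] n by auto
  obtain c d where cd: "c \<in> ?X - {a, b}" "d \<in> ?X - {a, b}"
    "\<And>x. x \<in> ?X - {b, c} \<Longrightarrow> orient b c x > 0" "\<And>x. x \<in> ?X - {d, a} \<Longrightarrow> orient d a x > 0"
    using hull_edge_neighbours[OF fin _ gp ab] n by auto
  \<comment> \<open>The points \<open>d\<close>, \<open>a\<close>, \<open>b\<close>,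
    \<open>c\<close> are consecutive hull vertices, hence the diagonals \<open>ac\<close> and
    \<open>bd\<close> cross.\<close>
  have cross: "closed_segment a c \<inter> closed_segment b d \<noteq> {}" if "c \<noteq> d"
  proof (rule segments_cross)
    show "orient a c b < 0" using ab(4)[OF cd(1)] orient_swap'[of a b c] by simp
    show "orient a c d > 0" using cd(4)[of c] cd(1) that orient_rotate[of d a c] by simp
    show "orient b d a > 0" using ab(4)[OF cd(2)] orient_rotate[of a b d] by simp
    show "orient b d c < 0" using cd(3)[of d] cd(2) that orient_swap'[of b c d] by simp
  qed
  have disj: "C1 \<inter> C2 = {}" using F unfolding facing_chains_def by blast
  consider "a \<in> C1 \<and> b \<in> C1 \<or> a \<in> C2 \<and> b \<in> C2" | "b \<in> C1 \<and> c \<in> C1 \<or> b \<in> C2 \<and> c \<in> C2"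
    | "d \<in> C1 \<and> a \<in> C1 \<or> d \<in> C2 \<and> a \<in> C2"
    | "a \<in> C1" "c \<in> C1" "b \<in> C2" "d \<in> C2" | "a \<in> C2" "c \<in> C2" "b \<in> C1" "d \<in> C1"
    using ab cd(1,2) by blast
  then show ?thesis
  proof cases
    case 1
    then show ?thesis using that[of a b] ab by blast
  next
    case 2
    then show ?thesis using that[of b c] cd by blast
  next
    case 3
    then show ?thesis using that[of d a] cd by blast
  next
    case 4
    then have "c \<noteq> d" using disj by blast
    then show ?thesis using cross facing_chains_chords_disjoint[OF F n] 4 by blast
  next
    case 5
    then have "c \<noteq> d" using disj by blast
    moreover have "closed_segment b d \<inter> closed_segment a c = {}"
      using facing_chains_chords_disjoint[OF F n] 5 by blast
    ultimately show ?thesis using cross by blast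
  qed
qed

text \<open>All that is kept of the cyclic order of points in convex position: chords whose end
  points do not interleave are disjoint. The case \<open>x = y\<close> is included.\<close>

definition noncross_list :: "(real^2) list \<Rightarrow> bool" where
  "noncross_list us \<longleftrightarrow> (\<forall>a b x y. a < b \<and> b < length us \<and> x < length us \<and> y < length us \<and>
     x \<noteq> a \<and> x \<noteq> b \<and> y \<noteq> a \<and> y \<noteq> b \<and> (a < x \<and> x < b \<longleftrightarrow> a < y \<and> y < b) \<longrightarrow>
     closed_segment (us!a) (us!b) \<inter> closed_segment (us!x) (us!y) = {})"

text \<open>Points between \<open>a\<close> and \<open>b\<close> are on one side of the chord, all
  others on the other side. The sign \<sigma> allows clockwise and counterclockwise lists.\<close>

lemma noncross_listI:
  assumes o: "\<And>i j k. i < j \<Longrightarrow> j < k \<Longrightarrow> k < length us \<Longrightarrow> \<sigma> * orient (us!i) (us!j) (us!k) > 0"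
  shows "noncross_list us"
  unfolding noncross_list_def
proof (intro allI impI)
  fix a b x y
  assume h: "a < b \<and> b < length us \<and> x < length us \<and> y < length us \<and>
     x \<noteq> a \<and> x \<noteq> b \<and> y \<noteq> a \<and> y \<noteq> b \<and> (a < x \<and> x < b \<longleftrightarrow> a < y \<and> y < b)"
  have inn: "\<sigma> * orient (us!a) (us!b) (us!z) < 0" if "a < z" "z < b" for z
    using o[of a z b] that h orient_swap'[of "us!a" "us!b" "us!z"] by simp
  have out: "\<sigma> * orient (us!a) (us!b) (us!z) > 0" if "z < a \<or> b < z" "z < length us" for z
    using that(1)
  proof
    assume "z < a"
    then show ?thesis using o[of z a b] h orient_rotate[of "us!z" "us!a" "us!b"] by simp
  next
    assume "b < z"
    then show ?thesis using o[of a b z] h that by simp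
  qed
  have "(\<sigma> * orient (us!a) (us!b) (us!x)) * (\<sigma> * orient (us!a) (us!b) (us!y)) > 0"
  proof (cases "a < x \<and> x < b")
    case True
    then have "a < y \<and> y < b" using h by blast
    then show ?thesis using inn True by (simp add: mult_neg_neg)
  next
    case False
    then have "x < a \<or> b < x" "y < a \<or> b < y" using h by auto
    then show ?thesis using out h by (simp add: mult_pos_pos)
  qed
  then have "\<sigma>^2 * (orient (us!a) (us!b) (us!x) * orient (us!a) (us!b) (us!y)) > 0"
    by (simp add: power2_eq_square algebra_simps)
  then have "orient (us!a) (us!b) (us!x) * orient (us!a) (us!b) (us!y) > 0"
    by (metis zero_le_power2 zero_less_mult_pos less_le mult_zero_left)
  then show "closed_segment (us!a) (us!b) \<inter> closed_segment (us!x) (us!y) = {}"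
    by (rule segment_disjoint_same_side)
qed

text \<open>For a set without an opposite chain to look from: the points are sorted around one of
  them, \<open>p\<close>. A wrongly oriented triple would have its middle point in the triangle of
  \<open>p\<close> and the other two.\<close>

lemma convex_position_noncross_list:
  assumes fin: "finite C" and gp: "general_position C" and cp: "convex_position C"
  obtains us where "distinct us" "set us = C" "noncross_list us"
proof (cases "C = {}")
  case True
  then show ?thesis using that[of "[]"] by (simp add: noncross_list_def)
next
  case False
  then obtain p where p: "p \<in> C" by blast
  have "p \<notin> convex hull (C - {p})" using cp p unfolding convex_position_def by blast
  then obtain vs where vs: "distinct vs" "set vs = C - {p}"
    "\<And>i j. i < j \<Longrightarrow> j < length vs \<Longrightarrow> orient p (vs!i) (vs!j) > 0"
    using angular_sort[of "C - {p}" p] fin general_position_orient[OF gp p] by (metis DiffE finite_Diff insertCI)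
  have "noncross_list (p # vs)"
  proof (rule noncross_listI[where \<sigma> = 1])
    fix i j k assume ijk: "i < j" "j < k" "k < length (p # vs)"
    then obtain j' k' where jk: "j = Suc j'" "k = Suc k'" by (cases j; cases k) auto
    show "1 * orient ((p # vs)!i) ((p # vs)!j) ((p # vs)!k) > 0"
    proof (cases i)
      case 0
      then show ?thesis using vs(3) ijk jk by simp
    next
      case (Suc i')
      let ?x = "vs!i'" and ?y = "vs!j'" and ?z = "vs!k'"
      have l: "i' < j'" "j' < k'" "k' < length vs" using ijk jk Suc by auto
      have mem: "?x \<in> C - {p}" "?y \<in> C - {p}" "?z \<in> C - {p}" using vs(2) l by (metis nth_mem order.strict_trans)+
      have ne: "?x \<noteq> ?y" "?y \<noteq> ?z" "?x \<noteq> ?z" using vs(1) l by (auto simp: nth_eq_iff_index_eq)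
      have o: "orient p ?x ?y > 0" "orient p ?y ?z > 0" using vs(3) l by auto
      have "orient ?x ?y ?z > 0"
      proof (rule ccontr)
        assume "\<not> ?thesis"
        moreover have "orient ?x ?y ?z \<noteq> 0" using general_position_orient[OF gp] mem ne by blast
        ultimately have "orient ?x ?y ?z < 0" by linarith
        then have "orient ?y ?x ?z > 0" using orient_swap[of ?x ?y ?z] by simp
        moreover have "orient ?y p ?x > 0" using o(1) orient_rotate[of p ?x ?y] orient_rotate[of ?x ?y p] by simp
        moreover have "orient ?y ?z p > 0" using o(2) orient_rotate[of p ?y ?z] by simp
        ultimately have "?y \<in> convex hull {p, ?x, ?z}" by (intro in_triangle)
        moreover have "{p, ?x, ?z} \<subseteq> C - {?y}" using mem ne p by auto
        ultimately have "?y \<in> convex hull (C - {?y})" using hull_mono by blast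
        then show False using cp mem unfolding convex_position_def by blast
      qed
      then show ?thesis using jk Suc by simp
    qed
  qed
  moreover have "distinct (p # vs)" "set (p # vs) = C" using vs p by auto
  ultimately show ?thesis using that by blast
qed

section \<open>The order of the chains\<close>

text \<open>
  In the ordinary double chain \<open>s = length us\<close>, and two cross edges are disjoint whenever their end
  points occur in the same order on both chains. The definition of a double chain also admits
  configurations in which one chain lies inside the triangle spanned by its own end point
  \<open>ls!0\<close>, \<open>us!0\<close> and the last point of \<open>us\<close>: then \<open>ls!0\<close> is the first point of its chain
  as seen from \<open>us!i\<close> with \<open>i < s\<close>, and the last one as seen from the other \<open>us!i\<close>.
\<close>

definition cross_order :: "(real^2) list \<Rightarrow> (real^2) list \<Rightarrow> nat \<Rightarrow> bool" where
  "cross_order us ls s \<longleftrightarrow>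
     (\<forall>i i' j k. i < i' \<longrightarrow> i' < length us \<longrightarrow> 0 < j \<longrightarrow> j < k \<longrightarrow> k < length ls \<longrightarrow>
        closed_segment (us!i) (ls!j) \<inter> closed_segment (us!i') (ls!k) = {}) \<and>
     (\<forall>i i' k. i < s \<longrightarrow> i < i' \<longrightarrow> i' < length us \<longrightarrow> 0 < k \<longrightarrow> k < length ls \<longrightarrow>
        closed_segment (us!i) (ls!0) \<inter> closed_segment (us!i') (ls!k) = {}) \<and>
     (\<forall>i i' k. s \<le> i \<longrightarrow> i' < i \<longrightarrow> i < length us \<longrightarrow> 0 < k \<longrightarrow> k < length ls \<longrightarrow>
        closed_segment (us!i) (ls!0) \<inter> closed_segment (us!i') (ls!k) = {})"

definition chain_order :: "(real^2) set \<Rightarrow> (real^2) set \<Rightarrow> (real^2) list \<Rightarrow> (real^2) list \<Rightarrow> nat \<Rightarrow> bool" where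
  "chain_order C1 C2 us ls s \<longleftrightarrow>
     distinct us \<and> set us = C1 \<and> distinct ls \<and> set ls = C2 \<and> noncross_list us \<and> noncross_list ls \<and>
     0 < s \<and> s \<le> length us \<and> cross_order us ls s"

lemma cross_orderD:
  assumes "cross_order us ls s"
  shows "i < i' \<Longrightarrow> i' < length us \<Longrightarrow> 0 < j \<Longrightarrow> j < k \<Longrightarrow> k < length ls \<Longrightarrow>
      closed_segment (us!i) (ls!j) \<inter> closed_segment (us!i') (ls!k) = {}"
    and "i < s \<Longrightarrow> i < i' \<Longrightarrow> i' < length us \<Longrightarrow> 0 < k \<Longrightarrow> k < length ls \<Longrightarrow>
      closed_segment (us!i) (ls!0) \<inter> closed_segment (us!i') (ls!k) = {}"
    and "s \<le> i \<Longrightarrow> i' < i \<Longrightarrow> i < length us \<Longrightarrow> 0 < k \<Longrightarrow> k < length ls \<Longrightarrow>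
      closed_segment (us!i) (ls!0) \<inter> closed_segment (us!i') (ls!k) = {}"
  using assms by (simp_all add: cross_order_def)

lemma facing_chains_no_cycle:
  assumes F: "facing_chains C1 C2" and "q \<in> C2" "x \<in> C1" "y \<in> C1" "z \<in> C1"
    "orient q x y > 0" "orient q y z > 0" "orient q z x > 0"
  shows False
proof -
  have "q \<in> convex hull {x, y, z}" using assms by (intro in_triangle)
  moreover have "convex hull {x, y, z} \<subseteq> convex hull C1" using assms by (intro hull_mono) auto
  ultimately show False using facing_chains_not_in_hull[OF F assms(2)] by blast
qed

text \<open>Moving from \<open>u\<close> to \<open>v\<close>, the order of three points of the opposite chain either persists or its
  first point becomes the last one.\<close>

lemma facing_chains_flip:
  assumes F: "facing_chains C1 C2" and uv: "u \<in> C1" "v \<in> C1" and o: "\<And>q. q \<in> C2 \<Longrightarrow> orient q u v > 0"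
    and m: "x \<in> C2" "y \<in> C2" "z \<in> C2"
    and u: "orient u x y < 0" "orient u y z < 0" "orient u x z < 0"
  shows "orient v y z < 0 \<and> (orient v x y < 0 \<longleftrightarrow> orient v x z < 0)"
proof -
  note F' = facing_chains_sym[OF F]
  have vis: "orient p q r < 0"
    if "w \<in> C1" "p \<in> C2" "q \<in> C2" "r \<in> C2" "orient w p q > 0" "orient w q r > 0" "orient w p r > 0" for w p q r
    using facing_chains_visible[OF F' that] .
  have cyc: False
    if "p \<in> C2" "q \<in> C2" "r \<in> C2" "orient v p q > 0" "orient v q r > 0" "orient v r p > 0" for p q r
    using facing_chains_no_cycle[OF F' uv(2) that] .
  have ne: "x \<noteq> y" "y \<noteq> z" "x \<noteq> z" using u by auto
  have "v \<noteq> x" "v \<noteq> y" "v \<noteq> z" using facing_chains_neq[OF F uv(2)] m by auto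
  then have nz: "orient v x y \<noteq> 0" "orient v y z \<noteq> 0" "orient v x z \<noteq> 0"
    using facing_chains_orient[OF F] uv m ne by blast+
  have sw: "orient v y x = - orient v x y" "orient v z y = - orient v y z" "orient v z x = - orient v x z"
    "orient u y x = - orient u x y" "orient u z y = - orient u y z" "orient u z x = - orient u x z"
    by (rule orient_swap')+
  \<comment> \<open>Seen from \<open>u\<close>, the counterclockwise order is \<open>z\<close>,
    \<open>y\<close>, \<open>x\<close>.\<close>
  have "orient z y x < 0" using vis[OF uv(1) m(3,2,1)] u sw by simp
  then have xyz: "orient x y z > 0" by (simp add: orient_def algebra_simps)
  have perm: "orient y x z = - orient x y z" "orient y z x = orient x y z" "orient z x y = orient x y z"
    by (simp_all add: orient_def algebra_simps)
  have yz: "orient v y z < 0"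
  proof (rule ccontr)
    assume "\<not> ?thesis"
    then have yz: "orient v y z > 0" using nz by linarith
    consider "orient v x y > 0" "orient v x z > 0" | "orient v x y > 0" "orient v x z < 0"
      | "orient v x y < 0" "orient v x z < 0" | "orient v x y < 0" "orient v x z > 0"
      using nz by linarith
    then show False
    proof cases
      case 1
      then show False using vis[OF uv(2) m(1,2,3)] yz xyz by auto
    next
      case 2
      then show False using cyc[OF m(1,2,3)] yz sw by auto
    next
      case 3
      then show False using vis[OF uv(2) m(2,3,1)] yz xyz sw perm by auto
    next
      case 4
      \<comment> \<open>Neither visibility nor acyclicity excludes this pattern. The Pluecker
        relation at \<open>x\<close> shows that it would reverse the order of \<open>u\<close> and
        \<open>v\<close> as seen from \<open>x\<close>.\<close>
      have r: "orient x u y = - orient u x y" "orient x u z = - orient u x z"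
        "orient x v y = - orient v x y" "orient x v z = - orient v x z"
        by (rule orient_swap)+
      have "orient x u y * orient x v z < 0" "orient x u z * orient x v y > 0"
        using r 4 u by (auto simp: mult_pos_neg mult_neg_pos mult_neg_neg)
      then have "orient x u v * orient x y z < 0"
        using orient_plucker[of x u v y z] by linarith
      then show False using xyz o[OF m(1)] by (simp add: mult_less_0_iff)
    qed
  qed
  moreover have "\<not> (orient v x y > 0 \<and> orient v x z < 0)"
    using vis[OF uv(2) m(3,1,2)] yz xyz sw perm by auto
  moreover have "\<not> (orient v x y < 0 \<and> orient v x z > 0)"
    using cyc[OF m(1,3,2)] yz sw by auto
  ultimately show ?thesis using nz by linarith
qed

text \<open>The hull edge makes \<open>a\<close> the first point of \<open>C1\<close> from every
  point of \<open>C2\<close>, which makes the whole order of \<open>C1\<close> independent of the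
  viewpoint. The order of \<open>C2\<close> is taken from \<open>us!0\<close>; along
  \<open>us\<close> it changes only as in \<open>facing_chains_flip\<close>.\<close>

lemma chain_order_exists_aux:
  assumes F: "facing_chains C1 C2" and ne: "C2 \<noteq> {}"
    and ab: "a \<noteq> b" "a \<in> C1" "b \<in> C1" and e: "\<And>x. x \<in> C1 \<union> C2 - {a, b} \<Longrightarrow> orient a b x > 0"
  obtains us ls s where "chain_order C1 C2 us ls s"
proof -
  note F' = facing_chains_sym[OF F]
  have fin: "finite C1" "finite C2" using F unfolding facing_chains_def by auto
  have nz: "orient q x y \<noteq> 0" if "q \<in> C2" "x \<in> C1" "y \<in> C1" "x \<noteq> y" for q x y
    using facing_chains_orient[OF F] facing_chains_neq[OF F] that by blast
  have nz': "orient q x y \<noteq> 0" if "q \<in> C1" "x \<in> C2" "y \<in> C2" "x \<noteq> y" for q x y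
    using facing_chains_orient[OF F'] facing_chains_neq[OF F'] that by blast
  \<comment> \<open>If \<open>x\<close> preceded \<open>a\<close>, then \<open>q\<close> would lie
    in the triangle \<open>x a b\<close>, or visibility would put \<open>x\<close> on the outer side
    of the hull edge.\<close>
  have first: "orient q a x > 0" if q: "q \<in> C2" and x: "x \<in> C1" "x \<noteq> a" for q x
  proof -
    have qab: "orient q a b > 0"
      using e[of q] q facing_chains_neq[OF F] ab orient_rotate[of q a b] by auto
    show ?thesis
    proof (cases "x = b")
      case False
      show ?thesis
      proof (rule ccontr)
        assume "\<not> ?thesis"
        then have xa: "orient q x a > 0" using nz[OF q x(1) ab(2) x(2)] orient_swap'[of q a x] by linarith
        have "orient q x b \<noteq> 0" using nz q x ab False by blast
        moreover have "\<not> orient q x b < 0"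
          using facing_chains_no_cycle[OF F q x(1) ab(2,3) xa qab] orient_swap'[of q x b] by auto
        ultimately have "orient x a b < 0"
          using facing_chains_visible[OF F q x(1) ab(2,3) xa qab] by auto
        then show False using e[of x] x False orient_rotate[of x a b] by auto
      qed
    qed (use qab in simp)
  qed
  \<comment> \<open>By visibility of \<open>a\<close>, \<open>x\<close>, \<open>y\<close>, the sign
    of \<open>orient a x y\<close> determines the order of \<open>x\<close> and \<open>y\<close>,
    whatever the viewpoint.\<close>
  have indep: "orient q' x y > 0"
    if q: "q \<in> C2" "q' \<in> C2" and xy: "x \<in> C1" "y \<in> C1" and pos: "orient q x y > 0" for q q' x y
  proof -
    have ne': "x \<noteq> y" using pos by auto
    have "y \<noteq> a" using first[OF q(1) xy(1)] pos orient_swap'[of q x a] ne' by force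
    show ?thesis
    proof (cases "x = a")
      case True
      then show ?thesis using first q xy ne' by blast
    next
      case False
      have 1: "orient a x y < 0"
        using facing_chains_visible[OF F q(1) ab(2) xy] first q xy False \<open>y \<noteq> a\<close> pos by blast
      show ?thesis
      proof (rule ccontr)
        assume "\<not> ?thesis"
        then have "orient q' y x > 0" using nz[OF q(2) xy ne'] orient_swap'[of q' x y] by linarith
        then have "orient a y x < 0"
          using facing_chains_visible[OF F q(2) ab(2) xy(2,1)] first q xy False \<open>y \<noteq> a\<close> by blast
        then show False using 1 orient_swap'[of a x y] by linarith
      qed
    qed
  qed
  obtain q0 where q0: "q0 \<in> C2" using ne by blast
  obtain us where us: "distinct us" "set us = C1"
    "\<And>i j. i < j \<Longrightarrow> j < length us \<Longrightarrow> orient q0 (us!i) (us!j) > 0"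
    using angular_sort[OF fin(1) facing_chains_not_in_hull[OF F q0]] nz[OF q0] by metis
  define m where "m = length us"
  have mem: "us!i \<in> C1" if "i < m" for i using us(2) that nth_mem m_def by blast
  have A: "orient q (us!i) (us!j) > 0" if "q \<in> C2" "i < j" "j < m" for q i j
    using indep[OF q0 that(1) mem mem us(3)] that by (auto simp: m_def)
  have ncu: "noncross_list us"
  proof (rule noncross_listI[where \<sigma> = "-1"])
    fix i j k assume "i < j" "j < k" "k < length us"
    then show "- 1 * orient (us!i) (us!j) (us!k) > 0"
      using facing_chains_visible[OF F q0 mem mem mem, of i j k] A[OF q0] by (simp add: m_def)
  qed
  have "length us \<noteq> 0" using us(2) ab by auto
  then have m0: "0 < m" by (simp add: m_def)
  obtain ws where ws: "distinct ws" "set ws = C2"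
    "\<And>i j. i < j \<Longrightarrow> j < length ws \<Longrightarrow> orient (us!0) (ws!i) (ws!j) > 0"
    using angular_sort[OF fin(2) facing_chains_not_in_hull[OF F' mem[OF m0]]] nz'[OF mem[OF m0]] by metis
  \<comment> \<open>Reversed so that both lists start at the same end: \<open>us\<close> is
    counterclockwise from \<open>C2\<close>, and \<open>ls\<close> is clockwise from
    \<open>us!0\<close>.\<close>
  define ls where "ls = rev ws"
  define n where "n = length ls"
  have ls: "distinct ls" "set ls = C2" using ws by (auto simp: ls_def)
  have memb: "ls!j \<in> C2" if "j < n" for j using ls(2) that nth_mem n_def by blast
  have lsne: "ls!j \<noteq> ls!k" if "j < k" "k < n" for j k
    using ls(1) that by (simp add: nth_eq_iff_index_eq n_def)
  have B0: "orient (us!0) (ls!j) (ls!k) < 0" if "j < k" "k < n" for j k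
    using ws(3)[of "n - Suc k" "n - Suc j"] that orient_swap'[of "us!0" "ls!j" "ls!k"]
    by (simp add: ls_def n_def rev_nth)
  have ncl: "noncross_list ls"
  proof (rule noncross_listI[where \<sigma> = 1])
    fix i j k assume ijk: "i < j" "j < k" "k < length ls"
    have "orient (us!0) (ls!k) (ls!j) > 0" "orient (us!0) (ls!j) (ls!i) > 0" "orient (us!0) (ls!k) (ls!i) > 0"
      using B0[of j k] B0[of i j] B0[of i k] ijk orient_swap'[of "us!0" "ls!k" "ls!j"]
        orient_swap'[of "us!0" "ls!j" "ls!i"] orient_swap'[of "us!0" "ls!k" "ls!i"]
      by (simp_all add: n_def)
    then have "orient (ls!k) (ls!j) (ls!i) < 0"
      using facing_chains_visible[OF F' mem[OF m0] memb memb memb, of k j i] ijk by (simp add: n_def)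
    moreover have "orient (ls!k) (ls!j) (ls!i) = - orient (ls!i) (ls!j) (ls!k)"
      by (simp add: orient_def algebra_simps)
    ultimately show "1 * orient (ls!i) (ls!j) (ls!k) > 0" by simp
  qed
  have flip: "orient (us!i) (ls!k) (ls!l) < 0 \<and> (orient (us!i) (ls!j) (ls!k) < 0 \<longleftrightarrow> orient (us!i) (ls!j) (ls!l) < 0)"
    if "0 < i" "i < m" "j < k" "k < l" "l < n" for i j k l
    using that by (intro facing_chains_flip[OF F, of "us!0"]) (auto intro: mem memb A B0)
  \<comment> \<open>Apart from \<open>ls!0\<close>, no point of \<open>ls\<close> ever changes its
    place.\<close>
  have W: "orient (us!i) (ls!j) (ls!k) < 0" if "i < m" "0 < j" "j < k" "k < n" for i j k
    using flip[of i 0 j k] B0[of j k] that by (cases "i = 0") auto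
  \<comment> \<open>From \<open>us!i\<close>, the point \<open>ls!0\<close> has become the last one;
    \<open>s\<close> is the least such index, or \<open>m\<close> if there is none.\<close>
  define \<phi> where "\<phi> i \<longleftrightarrow> 1 < n \<and> orient (us!i) (ls!0) (ls!1) > 0" for i
  define s where "s = (if \<exists>i<m. \<phi> i then LEAST i. i < m \<and> \<phi> i else m)"
  have n\<phi>0: "\<not> \<phi> 0" using B0[of 0 1] by (auto simp: \<phi>_def)
  have below: "\<not> \<phi> i" if "i < s" "i < m" for i
    using that not_less_Least[of i "\<lambda>i. i < m \<and> \<phi> i"] by (auto simp: s_def split: if_splits)
  have sle: "s < m \<Longrightarrow> \<phi> s" and sm: "s \<le> m"
  proof -
    have "s < m \<and> \<phi> s" if "\<exists>i<m. \<phi> i"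
      using that LeastI_ex[of "\<lambda>i. i < m \<and> \<phi> i"] by (auto simp: s_def)
    moreover have "s = m" if "\<not> (\<exists>i<m. \<phi> i)" unfolding s_def by (rule if_not_P[OF that])
    ultimately show "s < m \<Longrightarrow> \<phi> s" "s \<le> m" by (metis less_irrefl order.strict_implies_order order_refl)+
  qed
  have s0: "0 < s" using sle n\<phi>0 m0 by (cases "s = 0") auto
  have above: "\<phi> i" if "s \<le> i" "i < m" for i
  proof (cases "s = i")
    case True
    then show ?thesis using sle that by blast
  next
    case False
    have s: "\<phi> s" "s < i" using False that sle by auto
    then have n1: "1 < n" by (simp add: \<phi>_def)
    \<comment> \<open>As seen from \<open>ls!0\<close>, the ray to \<open>us!0\<close> is on one
      side of the line to \<open>ls!1\<close> and the ray to \<open>us!s\<close> on the other. Since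
      \<open>us!i\<close> comes later within the same half-turn, the Pluecker relation keeps it on
      the second side.\<close>
    let ?y = "ls!0" and ?z = "ls!1" and ?u = "us!0" and ?v = "us!s" and ?w = "us!i"
    have yC: "?y \<in> C2" using memb n1 by simp
    have "orient ?y ?u ?v > 0" "orient ?y ?v ?w > 0" "orient ?y ?u ?w > 0"
      using A[OF yC] s s0 that by auto
    moreover have "orient ?y ?z ?u < 0" "orient ?y ?z ?v > 0"
      using B0[of 0 1] s n1 orient_rotate[of ?u ?y ?z] orient_rotate[of ?v ?y ?z] by (auto simp: \<phi>_def)
    ultimately have "orient ?y ?z ?v * orient ?y ?u ?w > 0" "orient ?y ?z ?u * orient ?y ?v ?w < 0"
      by (auto simp: mult_neg_pos)
    then have "orient ?y ?z ?w * orient ?y ?u ?v > 0"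
      using orient_plucker[of ?y ?z ?w ?u ?v] orient_swap'[of ?y ?w ?v] orient_swap'[of ?y ?w ?u]
      by (auto simp: algebra_simps)
    then have "orient ?y ?z ?w > 0" using \<open>orient ?y ?u ?v > 0\<close> by (simp add: zero_less_mult_iff)
    then show ?thesis using n1 orient_rotate[of ?w ?y ?z] by (simp add: \<phi>_def)
  qed
  \<comment> \<open>The position of \<open>ls!0\<close> relative to \<open>ls!1\<close> decides its
    position relative to every \<open>ls!k\<close>.\<close>
  have S: "orient (us!i) (ls!0) (ls!k) < 0 \<longleftrightarrow> \<not> \<phi> i" if "i < m" "0 < k" "k < n" for i k
  proof -
    have "orient (us!i) (ls!0) (ls!1) \<noteq> 0"
      using nz'[OF mem[OF that(1)] memb memb] lsne[of 0 1] that by simp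
    then have 1: "orient (us!i) (ls!0) (ls!1) < 0 \<longleftrightarrow> \<not> \<phi> i"
      using that by (auto simp: \<phi>_def)
    show ?thesis
    proof (cases "i = 0")
      case True
      then show ?thesis using B0[of 0 k] n\<phi>0 that by simp
    next
      case False
      then show ?thesis using flip[of i 0 1 k] 1 that by (cases "k = 1") auto
    qed
  qed
  have S': "orient (us!i) (ls!0) (ls!k) > 0" if "i < m" "0 < k" "k < n" "\<phi> i" for i k
    using S[OF that(1-3)] that nz'[OF mem[OF that(1)] memb memb, of 0 k] lsne[of 0 k] by fastforce
  \<comment> \<open>The separating line goes through \<open>us!i'\<close> and \<open>ls!j\<close>;
    in \<open>bA\<close> and \<open>bB\<close> it goes through \<open>us!i\<close> and
    \<open>ls!k\<close>.\<close>
  have ww: "closed_segment (us!i) (ls!j) \<inter> closed_segment (us!i') (ls!k) = {}"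
    if "i < i'" "i' < m" "0 < j" "j < k" "k < n" for i i' j k
  proof (rule segment_disjoint_opposite_sides)
    have "orient (us!i') (ls!j) (us!i) > 0"
      using A[of "ls!j" i i'] memb that orient_rotate[of "us!i'" "ls!j" "us!i"] by simp
    then show "orient (us!i') (ls!j) (us!i) * orient (us!i') (ls!j) (ls!k) < 0"
      using W[of i' j k] that by (simp add: mult_pos_neg)
  qed
  have bA: "closed_segment (us!i) (ls!0) \<inter> closed_segment (us!i') (ls!k) = {}"
    if "i < s" "i < i'" "i' < m" "0 < k" "k < n" for i i' k
  proof -
    have "orient (us!i) (ls!k) (us!i') < 0"
      using A[of "ls!k" i i'] memb that orient_swap'[of "us!i" "ls!k" "us!i'"] orient_rotate[of "ls!k" "us!i" "us!i'"]
      by simp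
    moreover have "orient (us!i) (ls!k) (ls!0) > 0"
      using S[of i k] below that orient_swap'[of "us!i" "ls!0" "ls!k"] by simp
    ultimately have "closed_segment (us!i') (ls!k) \<inter> closed_segment (us!i) (ls!0) = {}"
      by (intro segment_disjoint_opposite_sides) (simp add: mult_neg_pos)
    then show ?thesis by blast
  qed
  have bB: "closed_segment (us!i) (ls!0) \<inter> closed_segment (us!i') (ls!k) = {}"
    if "s \<le> i" "i' < i" "i < m" "0 < k" "k < n" for i i' k
  proof -
    have "orient (us!i) (ls!k) (us!i') > 0"
      using A[of "ls!k" i' i] memb that orient_rotate[of "us!i" "ls!k" "us!i'"] by simp
    moreover have "orient (us!i) (ls!k) (ls!0) < 0"
      using S'[of i k] above that orient_swap'[of "us!i" "ls!0" "ls!k"] by simp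
    ultimately have "closed_segment (us!i') (ls!k) \<inter> closed_segment (us!i) (ls!0) = {}"
      by (intro segment_disjoint_opposite_sides) (simp add: mult_pos_neg)
    then show ?thesis by blast
  qed
  have "cross_order us ls s"
    unfolding cross_order_def m_def[symmetric] n_def[symmetric]
    by (intro conjI allI impI ww bA bB)
  then have "chain_order C1 C2 us ls s"
    unfolding chain_order_def using us(1,2) ls ncu ncl s0 sm m_def by simp
  then show ?thesis using that by blast
qed

section \<open>Reversing the order of the chains\<close>

lemma noncross_listD:
  assumes "noncross_list us" "a < length us" "b < length us" "x < length us" "y < length us"
    "a \<noteq> b" "x \<noteq> a" "x \<noteq> b" "y \<noteq> a" "y \<noteq> b"
    "min a b < x \<and> x < max a b \<longleftrightarrow> min a b < y \<and> y < max a b"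
  shows "closed_segment (us!a) (us!b) \<inter> closed_segment (us!x) (us!y) = {}"
proof (cases "a < b")
  case True
  then show ?thesis using assms unfolding noncross_list_def by (simp add: min_def max_def)
next
  case False
  then have "b < a" using assms by simp
  then have "closed_segment (us!b) (us!a) \<inter> closed_segment (us!x) (us!y) = {}"
    using assms unfolding noncross_list_def by (simp add: min_def max_def)
  then show ?thesis by (simp add: closed_segment_commute)
qed

lemma noncross_list_rev:
  assumes "noncross_list us"
  shows "noncross_list (rev us)"
  unfolding noncross_list_def length_rev
proof (intro allI impI)
  fix a b x y
  assume h: "a < b \<and> b < length us \<and> x < length us \<and> y < length us \<and>
     x \<noteq> a \<and> x \<noteq> b \<and> y \<noteq> a \<and> y \<noteq> b \<and> (a < x \<and> x < b \<longleftrightarrow> a < y \<and> y < b)"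
  define \<rho> where "\<rho> j = length us - Suc j" for j
  have "closed_segment (us ! \<rho> a) (us ! \<rho> b) \<inter> closed_segment (us ! \<rho> x) (us ! \<rho> y) = {}"
  proof (rule noncross_listD[OF assms])
    show "\<rho> a < length us" "\<rho> b < length us" "\<rho> x < length us" "\<rho> y < length us"
      using h by (auto simp: \<rho>_def)
    show "\<rho> a \<noteq> \<rho> b" "\<rho> x \<noteq> \<rho> a" "\<rho> x \<noteq> \<rho> b" "\<rho> y \<noteq> \<rho> a" "\<rho> y \<noteq> \<rho> b"
      using h unfolding \<rho>_def by arith+
    have "min (\<rho> a) (\<rho> b) = \<rho> b" "max (\<rho> a) (\<rho> b) = \<rho> a" using h by (auto simp: \<rho>_def)
    moreover have "\<rho> b < \<rho> z \<and> \<rho> z < \<rho> a \<longleftrightarrow> a < z \<and> z < b" if "z < length us" for z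
      using h that unfolding \<rho>_def by arith
    ultimately show "min (\<rho> a) (\<rho> b) < \<rho> x \<and> \<rho> x < max (\<rho> a) (\<rho> b) \<longleftrightarrow>
        min (\<rho> a) (\<rho> b) < \<rho> y \<and> \<rho> y < max (\<rho> a) (\<rho> b)"
      using h by simp
  qed
  then show "closed_segment (rev us ! a) (rev us ! b) \<inter> closed_segment (rev us ! x) (rev us ! y) = {}"
    using h by (simp add: rev_nth \<rho>_def)
qed

text \<open>Reverses the cyclic order but keeps the head, since the exceptional point
  \<open>ls!0\<close> of \<open>cross_order\<close> has to stay at position 0.\<close>

definition reflect :: "'a list \<Rightarrow> 'a list" where
  "reflect ls = hd ls # rev (tl ls)"

lemma nth_reflect:
  assumes "j < length ls"
  shows "reflect ls ! j = (if j = 0 then ls!0 else ls!(length ls - j))"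
proof (cases j)
  case 0
  then show ?thesis using assms by (cases ls) (auto simp: reflect_def)
next
  case (Suc i)
  then show ?thesis using assms by (cases ls) (auto simp: reflect_def rev_nth)
qed

lemma reflect_simps:
  assumes "ls \<noteq> []"
  shows "length (reflect ls) = length ls" "set (reflect ls) = set ls" "distinct (reflect ls) = distinct ls"
  using assms by (cases ls; simp add: reflect_def)+

lemma noncross_list_reflect:
  assumes "noncross_list ls" "ls \<noteq> []"
  shows "noncross_list (reflect ls)"
  unfolding noncross_list_def reflect_simps(1)[OF assms(2)]
proof (intro allI impI)
  fix a b x y
  assume h: "a < b \<and> b < length ls \<and> x < length ls \<and> y < length ls \<and>
     x \<noteq> a \<and> x \<noteq> b \<and> y \<noteq> a \<and> y \<noteq> b \<and> (a < x \<and> x < b \<longleftrightarrow> a < y \<and> y < b)"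
  define \<rho> where "\<rho> j = (if j = 0 then 0 else length ls - j)" for j
  have e: "reflect ls ! j = ls ! \<rho> j" if "j < length ls" for j
    using nth_reflect[OF that] by (simp add: \<rho>_def)
  have "closed_segment (ls ! \<rho> a) (ls ! \<rho> b) \<inter> closed_segment (ls ! \<rho> x) (ls ! \<rho> y) = {}"
  proof (rule noncross_listD[OF assms(1)])
    show "\<rho> a < length ls" "\<rho> b < length ls" "\<rho> x < length ls" "\<rho> y < length ls"
      using h by (auto simp: \<rho>_def)
    show "\<rho> a \<noteq> \<rho> b" "\<rho> x \<noteq> \<rho> a" "\<rho> x \<noteq> \<rho> b" "\<rho> y \<noteq> \<rho> a" "\<rho> y \<noteq> \<rho> b"
      using h by (auto simp: \<rho>_def split: if_splits)
    have "min (\<rho> a) (\<rho> b) < \<rho> z \<and> \<rho> z < max (\<rho> a) (\<rho> b) \<longleftrightarrow> (a < z \<and> z < b) = (a \<noteq> 0)"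
      if "z < length ls" "z \<noteq> a" "z \<noteq> b" for z
    proof (cases "a = 0")
      case True
      then have "min (\<rho> a) (\<rho> b) = 0" "max (\<rho> a) (\<rho> b) = length ls - b" using h by (auto simp: \<rho>_def)
      then show ?thesis using True h that by (auto simp: \<rho>_def)
    next
      case False
      then have "min (\<rho> a) (\<rho> b) = length ls - b" "max (\<rho> a) (\<rho> b) = length ls - a" using h by (auto simp: \<rho>_def)
      then show ?thesis using False h that by (auto simp: \<rho>_def)
    qed
    then show "min (\<rho> a) (\<rho> b) < \<rho> x \<and> \<rho> x < max (\<rho> a) (\<rho> b) \<longleftrightarrow>
        min (\<rho> a) (\<rho> b) < \<rho> y \<and> \<rho> y < max (\<rho> a) (\<rho> b)"
      using h by simp
  qed
  then show "closed_segment (reflect ls ! a) (reflect ls ! b) \<inter>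
      closed_segment (reflect ls ! x) (reflect ls ! y) = {}"
    using e h by simp
qed

text \<open>Reading \<open>us\<close> backwards exchanges the second and third clauses of
  \<open>cross_order\<close>, that is, the points that see \<open>ls!0\<close> first and those that
  see it last.\<close>

lemma cross_order_mirror:
  assumes O: "cross_order us ls s" and ne: "ls \<noteq> []"
  shows "cross_order (rev us) (reflect ls) (length us - s)"
  unfolding cross_order_def length_rev reflect_simps(1)[OF ne]
proof (intro conjI allI impI)
  let ?m = "length us" and ?n = "length ls"
  have un: "rev us ! i = us ! (?m - Suc i)" if "i < ?m" for i using that by (rule rev_nth)
  have ln0: "reflect ls ! 0 = ls ! 0" using nth_reflect[of 0 ls] ne by simp
  have ln: "reflect ls ! j = ls ! (?n - j)" if "0 < j" "j < ?n" for j
    using nth_reflect[of j ls] that by simp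
  fix i i' j k assume h: "i < i'" "i' < ?m" "0 < j" "j < k" "k < ?n"
  have "closed_segment (us!(?m - Suc i')) (ls!(?n - k)) \<inter> closed_segment (us!(?m - Suc i)) (ls!(?n - j)) = {}"
    by (rule cross_orderD(1)[OF O]) (use h in auto)
  then show "closed_segment (rev us!i) (reflect ls!j) \<inter> closed_segment (rev us!i') (reflect ls!k) = {}"
    using un[of i] un[of i'] ln[of j] ln[of k] h by (simp add: Int_commute)
next
  let ?m = "length us" and ?n = "length ls"
  fix i i' k assume h: "i < ?m - s" "i < i'" "i' < ?m" "0 < k" "k < ?n"
  have "closed_segment (us!(?m - Suc i)) (ls!0) \<inter> closed_segment (us!(?m - Suc i')) (ls!(?n - k)) = {}"
    by (rule cross_orderD(3)[OF O]) (use h in auto)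
  then show "closed_segment (rev us!i) (reflect ls!0) \<inter> closed_segment (rev us!i') (reflect ls!k) = {}"
    using h nth_reflect[of 0 ls] nth_reflect[of k ls] ne by (simp add: rev_nth)
next
  let ?m = "length us" and ?n = "length ls"
  fix i i' k assume h: "?m - s \<le> i" "i' < i" "i < ?m" "0 < k" "k < ?n"
  have "closed_segment (us!(?m - Suc i)) (ls!0) \<inter> closed_segment (us!(?m - Suc i')) (ls!(?n - k)) = {}"
    by (rule cross_orderD(2)[OF O]) (use h in auto)
  then show "closed_segment (rev us!i) (reflect ls!0) \<inter> closed_segment (rev us!i') (reflect ls!k) = {}"
    using h nth_reflect[of 0 ls] nth_reflect[of k ls] ne by (simp add: rev_nth)
qed

lemma chain_order_mirror:
  assumes O: "chain_order C1 C2 us ls s" and s: "s < length us" and ne: "ls \<noteq> []"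
  shows "chain_order C1 C2 (rev us) (reflect ls) (length us - s)"
  using assms unfolding chain_order_def
  by (simp add: reflect_simps noncross_list_rev noncross_list_reflect cross_order_mirror)

text \<open>The mirror image turns \<open>s = 1\<close> into \<open>length us - 1\<close>. The
  normalisation is needed because stars at the end of the chains also join \<open>us!1\<close> to
  \<open>ls!0\<close>, for which \<open>1 < s\<close> is required.\<close>

lemma chain_order_exists:
  assumes F: "facing_chains C1 C2" and n: "card (C1 \<union> C2) \<ge> 5" and ne: "C1 \<noteq> {}" "C2 \<noteq> {}"
  obtains us ls s D1 D2 where "(D1, D2) = (C1, C2) \<or> (D1, D2) = (C2, C1)" "chain_order D1 D2 us ls s"
    "s = length us \<or> 2 \<le> s \<or> length us = 2"
proof -
  obtain a b where ab: "a \<noteq> b" "(a \<in> C1 \<and> b \<in> C1) \<or> (a \<in> C2 \<and> b \<in> C2)"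
    "\<And>x. x \<in> C1 \<union> C2 - {a, b} \<Longrightarrow> orient a b x > 0"
    using monochain_hull_edge[OF F n] by blast
  obtain D1 D2 us ls s where D: "(D1, D2) = (C1, C2) \<or> (D1, D2) = (C2, C1)" and O: "chain_order D1 D2 us ls s"
  proof (cases "a \<in> C1 \<and> b \<in> C1")
    case True
    obtain us ls s where "chain_order C1 C2 us ls s"
      by (rule chain_order_exists_aux[OF F ne(2) ab(1) _ _ ab(3)]) (use True in auto)
    then show ?thesis by (rule that[rotated]) simp
  next
    case False
    then have "a \<in> C2" "b \<in> C2" using ab by auto
    then obtain us ls s where "chain_order C2 C1 us ls s"
      using ab(3) by (elim chain_order_exists_aux[OF facing_chains_sym[OF F] ne(1) ab(1)]) auto
    then show ?thesis by (rule that[rotated]) simp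
  qed
  show ?thesis
  proof (cases "s = length us \<or> 2 \<le> s \<or> length us = 2")
    case True
    then show ?thesis by (rule that[OF D O])
  next
    case False
    have "s > 0" "s \<le> length us" "set ls = D2" using O unfolding chain_order_def by auto
    then have "s < length us" "2 \<le> length us - s" using False by auto
    moreover have "ls \<noteq> []" using \<open>set ls = D2\<close> D ne by auto
    ultimately show ?thesis by (intro that[OF D chain_order_mirror[OF O]]) auto
  qed
qed

section \<open>Unobstructed stars\<close>

definition unobstructed :: "(real^2) set \<Rightarrow> (real^2) set \<Rightarrow> real^2 \<Rightarrow> bool" where
  "unobstructed X S c \<longleftrightarrow>
     (\<forall>x\<in>X - S. \<forall>y\<in>X - S. \<forall>z\<in>S - {c}. closed_segment c z \<inter> closed_segment x y = {})"

definition separated :: "(real^2) set \<Rightarrow> (real^2) set \<Rightarrow> bool" where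
  "separated C S \<longleftrightarrow> (\<forall>a\<in>S \<inter> C. \<forall>b\<in>S \<inter> C. \<forall>x\<in>C - S. \<forall>y\<in>C - S. a \<noteq> b \<longrightarrow>
     closed_segment a b \<inter> closed_segment x y = {})"

lemma separatedD:
  assumes "separated C S" "a \<in> S" "a \<in> C" "b \<in> S" "b \<in> C" "x \<in> C" "x \<notin> S" "y \<in> C" "y \<notin> S" "a \<noteq> b"
  shows "closed_segment a b \<inter> closed_segment x y = {}"
  using assms by (simp add: separated_def)

text \<open>Only two positions of \<open>x\<close>, \<open>y\<close>, \<open>z\<close> need a
  hypothesis: all three in the chain of \<open>c\<close>, or both segments running between the
  chains. The facing property excludes a crossing in all others.\<close>

lemma unobstructedI_aux:
  assumes F: "facing_chains C1 C2" and n: "card (C1 \<union> C2) \<ge> 5"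
    and S: "c \<in> S" "c \<in> C1" "S \<subseteq> C1 \<union> C2"
    and sep: "separated C1 S"
    and cr: "\<And>q x y. q \<in> S \<inter> C2 \<Longrightarrow> x \<in> C1 - S \<Longrightarrow> y \<in> C2 - S \<Longrightarrow> closed_segment c q \<inter> closed_segment x y = {}"
  shows "unobstructed (C1 \<union> C2) S c"
  unfolding unobstructed_def
proof (intro ballI)
  fix x y z assume h: "x \<in> C1 \<union> C2 - S" "y \<in> C1 \<union> C2 - S" "z \<in> S - {c}"
  note F' = facing_chains_sym[OF F]
  have xy: "x \<noteq> c" "y \<noteq> c" "x \<noteq> z" "y \<noteq> z" using h S by auto
  have comm: "closed_segment y x = closed_segment x y" by (rule closed_segment_commute)
  show "closed_segment c z \<inter> closed_segment x y = {}"
  proof (cases "z \<in> C1")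
    case z: True
    consider "x \<in> C1" "y \<in> C1" | "x \<in> C1" "y \<in> C2" | "x \<in> C2" "y \<in> C1" | "x \<in> C2" "y \<in> C2"
      using h by blast
    then show ?thesis
    proof cases
      case 1
      then show ?thesis using separatedD[OF sep S(1,2) _ z] h by blast
    next
      case 2
      then show ?thesis using facing_chains_chord_disjoint[OF F 2 S(2) z] xy by blast
    next
      case 3
      then show ?thesis using facing_chains_chord_disjoint[OF F 3(2,1) S(2) z] xy comm by blast
    next
      case 4
      then show ?thesis using facing_chains_chords_disjoint[OF F n S(2) z] by blast
    qed
  next
    case False
    then have z: "z \<in> C2" using h S by blast
    consider "x \<in> C1" "y \<in> C1" | "x \<in> C1" "y \<in> C2" | "x \<in> C2" "y \<in> C1" | "x \<in> C2" "y \<in> C2"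
      using h by blast
    then show ?thesis
    proof cases
      case 1
      then show ?thesis using facing_chains_chord_disjoint[OF F S(2) z] xy by blast
    next
      case 2
      then show ?thesis using cr z h by blast
    next
      case 3
      then show ?thesis using cr[of z y x] z h comm by blast
    next
      case 4
      then show ?thesis
        using facing_chains_chord_disjoint[OF F' z S(2) 4] xy closed_segment_commute[of c z] by blast
    qed
  qed
qed

lemma unobstructedI:
  assumes F: "facing_chains C1 C2" and n: "card (C1 \<union> C2) \<ge> 5"
    and S: "c \<in> S" "S \<subseteq> C1 \<union> C2"
    and sep: "separated C1 S" "separated C2 S"
    and cr: "\<And>p q x y. p \<in> S \<inter> C1 \<Longrightarrow> q \<in> S \<inter> C2 \<Longrightarrow> c = p \<or> c = q \<Longrightarrow> x \<in> C1 - S \<Longrightarrow> y \<in> C2 - S \<Longrightarrow>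
      closed_segment p q \<inter> closed_segment x y = {}"
  shows "unobstructed (C1 \<union> C2) S c"
proof (cases "c \<in> C1")
  case True
  then show ?thesis using S cr by (intro unobstructedI_aux[OF F n S(1) _ S(2) sep(1)]) auto
next
  case False
  then have c: "c \<in> C2" using S by blast
  have "unobstructed (C2 \<union> C1) S c"
  proof (rule unobstructedI_aux[OF facing_chains_sym[OF F] _ S(1) c _ sep(2)])
    show "5 \<le> card (C2 \<union> C1)" "S \<subseteq> C2 \<union> C1" using n S by (auto simp: Un_commute)
    show "closed_segment c q \<inter> closed_segment x y = {}" if "q \<in> S \<inter> C1" "x \<in> C2 - S" "y \<in> C1 - S" for q x y
    proof -
      have "closed_segment q c \<inter> closed_segment y x = {}" using cr[of q c y x] that S c by blast
      then show ?thesis by (metis closed_segment_commute)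
    qed
  qed
  then show ?thesis by (simp add: Un_commute)
qed

text \<open>The complement of an interval represents an arc that passes from position
  \<open>m - 1\<close> to position 0.\<close>

definition cyclic_interval :: "nat \<Rightarrow> nat set \<Rightarrow> bool" where
  "cyclic_interval m I \<longleftrightarrow> I \<subseteq> {..<m} \<and> (\<exists>lo hi. I = {lo..<hi} \<or> I = {..<m} - {lo..<hi})"

text \<open>Two positions on an arc never interleave with two positions outside it.\<close>

lemma separated_cyclic_interval:
  assumes "noncross_list us" "distinct us" and I: "cyclic_interval (length us) I"
    and S: "S \<inter> set us = (!) us ` I"
  shows "separated (set us) S"
  unfolding separated_def
proof (intro ballI impI)
  fix p q v w assume h: "p \<in> S \<inter> set us" "q \<in> S \<inter> set us" "v \<in> set us - S" "w \<in> set us - S" "p \<noteq> q"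
  obtain a b where ab: "a \<in> I" "b \<in> I" "p = us!a" "q = us!b" using h S by auto
  obtain x y where xy: "x < length us" "y < length us" "v = us!x" "w = us!y"
    using h by (metis DiffD1 in_set_conv_nth)
  have il: "I \<subseteq> {..<length us}" using I by (simp add: cyclic_interval_def)
  have nI: "x \<notin> I" "y \<notin> I" using h xy S by auto
  show "closed_segment p q \<inter> closed_segment v w = {}"
    unfolding ab xy
  proof (rule noncross_listD[OF assms(1)])
    show "a < length us" "b < length us" "x < length us" "y < length us" using ab xy il by auto
    show "a \<noteq> b" "x \<noteq> a" "x \<noteq> b" "y \<noteq> a" "y \<noteq> b" using h ab nI by auto
    obtain lo hi where "I = {lo..<hi} \<or> I = {..<length us} - {lo..<hi}" using I by (auto simp: cyclic_interval_def)
    then show "min a b < x \<and> x < max a b \<longleftrightarrow> min a b < y \<and> y < max a b"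
      using ab xy nI by (auto simp: min_def max_def)
  qed
qed

text \<open>Condition \<open>ok\<close> concerns the star's edges between the chains. Either
  everything before \<open>us!i\<close> and \<open>ls!j\<close> belongs to the star, so remaining
  cross edges end later on both chains; or the edge ends in \<open>ls!0\<close> beyond the index
  \<open>s\<close> and everything after \<open>us!i\<close> belongs to the star, so they end earlier
  on \<open>us\<close>.\<close>

lemma chain_order_unobstructed:
  assumes F: "facing_chains C1 C2" and n: "card (C1 \<union> C2) \<ge> 5" and O: "chain_order C1 C2 us ls s"
    and IJ: "cyclic_interval (length us) I" "cyclic_interval (length ls) J"
    and S: "S = (!) us ` I \<union> (!) ls ` J" and c: "c \<in> S"
    and ok: "\<And>i j. i \<in> I \<Longrightarrow> j \<in> J \<Longrightarrow> c = us!i \<or> c = ls!j \<Longrightarrow>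
      {..i} \<subseteq> I \<and> {..j} \<subseteq> J \<and> (j = 0 \<longrightarrow> i < s) \<or> j = 0 \<and> s \<le> i \<and> {i..<length us} \<subseteq> I"
  shows "unobstructed (C1 \<union> C2) S c"
proof (rule unobstructedI[OF F n c])
  have sets: "set us = C1" "set ls = C2" "distinct us" "distinct ls" "noncross_list us" "noncross_list ls"
    and O': "cross_order us ls s" using O unfolding chain_order_def by auto
  have il: "I \<subseteq> {..<length us}" "J \<subseteq> {..<length ls}" using IJ by (auto simp: cyclic_interval_def)
  have sub: "(!) us ` I \<subseteq> C1" "(!) ls ` J \<subseteq> C2" using il sets nth_mem by blast+
  have disj: "C1 \<inter> C2 = {}" using F unfolding facing_chains_def by blast
  have S1: "S \<inter> C1 = (!) us ` I" and S2: "S \<inter> C2 = (!) ls ` J" using S sub disj by auto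
  show "S \<subseteq> C1 \<union> C2" using S sub by blast
  show "separated C1 S" "separated C2 S"
    using separated_cyclic_interval[OF sets(5,3) IJ(1), of S] separated_cyclic_interval[OF sets(6,4) IJ(2), of S]
      S1 S2 sets by auto
  fix p q x y assume h: "p \<in> S \<inter> C1" "q \<in> S \<inter> C2" "c = p \<or> c = q" "x \<in> C1 - S" "y \<in> C2 - S"
  obtain i where i: "i \<in> I" "p = us!i" using h S1 by auto
  obtain j where j: "j \<in> J" "q = ls!j" using h S2 by auto
  obtain i' where i': "i' < length us" "x = us!i'" using h sets(1) by (metis DiffD1 in_set_conv_nth)
  obtain k where k: "k < length ls" "y = ls!k" using h sets(2) by (metis DiffD1 in_set_conv_nth)
  have nI: "i' \<notin> I" "k \<notin> J" using h i' k S by auto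
  have c': "c = us!i \<or> c = ls!j" using h i j by auto
  have il': "i < length us" "j < length ls" using il i j by auto
  from ok[OF i(1) j(1) c'] show "closed_segment p q \<inter> closed_segment x y = {}"
  proof
    assume a: "{..i} \<subseteq> I \<and> {..j} \<subseteq> J \<and> (j = 0 \<longrightarrow> i < s)"
    then have lt: "i < i'" "j < k" using nI by (auto simp: subset_iff not_le[symmetric])
    show ?thesis
    proof (cases "j = 0")
      case True
      then have "i < s" "0 < k" using a lt by auto
      then show ?thesis
        unfolding i(2) j(2) i'(2) k(2) True using cross_orderD(2)[OF O'] lt i'(1) k(1) by blast
    next
      case False
      then have "0 < j" by simp
      then show ?thesis
        unfolding i(2) j(2) i'(2) k(2) using cross_orderD(1)[OF O'] lt i'(1) k(1) by blast
    qed
  next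
    assume a: "j = 0 \<and> s \<le> i \<and> {i..<length us} \<subseteq> I"
    then have lt: "i' < i" using nI i' by (auto simp: subset_iff not_le[symmetric])
    have "0 < k" using nI j a by (cases k) auto
    then show ?thesis
      unfolding i(2) j(2) i'(2) k(2) using cross_orderD(3)[OF O'] lt il' a k(1) by blast
  qed
qed

section \<open>Cyclic windows\<close>

definition red_count :: "(real^2) list \<Rightarrow> (real^2) set \<Rightarrow> nat \<Rightarrow> nat" where
  "red_count us R i = (\<Sum>k<4. of_bool (us ! ((i + k) mod length us) \<in> R))"

lemma sum_lessThan_4: "(\<Sum>k<4. f k) = f 0 + f 1 + f 2 + f (3::nat)" for f :: "nat \<Rightarrow> nat"
  by (simp add: numeral_eq_Suc)

lemma sum_nth_shift:
  fixes c :: "nat \<Rightarrow> nat"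
  assumes "0 < m"
  shows "(\<Sum>i<m. c ((i + k) mod m)) = (\<Sum>i<m. c i)"
proof (induction k)
  case 0
  show ?case by (intro sum.cong) auto
next
  case (Suc k)
  obtain p where p: "m = Suc p" using assms by (cases m) auto
  let ?c = "\<lambda>i. c ((i + k) mod m)"
  have "c ((i + Suc k) mod m) = ?c (Suc i mod m)" for i by (simp add: mod_add_left_eq)
  then have "(\<Sum>i<m. c ((i + Suc k) mod m)) = (\<Sum>i<m. ?c (Suc i mod m))" by simp
  also have "\<dots> = (\<Sum>i<p. ?c (Suc i mod m)) + ?c (Suc p mod m)" unfolding p by (rule sum.lessThan_Suc)
  also have "(\<Sum>i<p. ?c (Suc i mod m)) = (\<Sum>i<p. ?c (Suc i))" by (intro sum.cong) (auto simp: p)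
  also have "?c (Suc p mod m) = ?c 0" by (simp add: p)
  also have "(\<Sum>i<p. ?c (Suc i)) + ?c 0 = (\<Sum>i<m. ?c i)" unfolding p sum.lessThan_Suc_shift by simp
  finally show ?case using Suc by simp
qed

text \<open>Double counting: each position is counted once for each of the four offsets of a
  window.\<close>

lemma sum_red_count:
  assumes "distinct us" "us \<noteq> []"
  shows "(\<Sum>i<length us. red_count us R i) = 4 * card (set us \<inter> R)"
proof -
  let ?m = "length us" and ?c = "\<lambda>i. of_bool (us ! i \<in> R) :: nat"
  have "(\<Sum>i<?m. red_count us R i) = (\<Sum>k<4. \<Sum>i<?m. ?c ((i + k) mod ?m))"
    unfolding red_count_def by (rule sum.swap)
  also have "\<dots> = 4 * (\<Sum>i<?m. ?c i)" using assms sum_nth_shift[of ?m ?c] by simp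
  also have "(\<Sum>i<?m. ?c i) = (\<Sum>x\<in>set us. of_bool (x \<in> R))"
    by (rule sum.reindex_bij_betw[OF bij_betw_nth[OF assms(1)]]) auto
  also have "\<dots> = card (set us \<inter> R)" by (simp add: Int_def)
  finally show ?thesis .
qed

lemma red_count_step:
  "red_count us R i \<le> red_count us R (Suc i) + 1 \<and> red_count us R (Suc i) \<le> red_count us R i + 1"
proof -
  define c where "c j = (of_bool (us ! (j mod length us) \<in> R) :: nat)" for j
  have r: "red_count us R j = c j + c (j + 1) + c (j + 2) + c (j + 3)" for j
    unfolding red_count_def sum_lessThan_4 c_def by simp
  have "c (Suc i) = c (i + 1)" "c (Suc i + 1) = c (i + 2)" "c (Suc i + 2) = c (i + 3)"
    by (rule arg_cong[of _ _ c]; simp)+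
  moreover have "c i \<le> 1" "c (Suc i + 3) \<le> 1" by (simp_all add: c_def)
  ultimately show ?thesis unfolding r[of i] r[of "Suc i"] by linarith
qed

lemma red_count_le: "red_count us R i \<le> 4"
  unfolding red_count_def sum_lessThan_4 by (simp add: of_bool_def)

text \<open>A discrete intermediate value argument: with steps of at most one, the count cannot pass
  between 0 and 2 without taking the value 1.\<close>

lemma red_count_no_one:
  assumes "\<And>i. i < m \<Longrightarrow> red_count us R i \<noteq> 1"
  shows "(\<forall>i<m. red_count us R i = 0) \<or> (\<forall>i<m. 2 \<le> red_count us R i)"
proof -
  have "(red_count us R i = 0) = (red_count us R 0 = 0)" if "i < m" for i
    using that
  proof (induction i)
    case (Suc i)
    then show ?case using assms[of i] assms[of "Suc i"] red_count_step[of us R i] by auto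
  qed simp
  then show ?thesis using assms by (metis One_nat_def less_2_cases not_le)
qed

text \<open>Values in 0, 2, 4 that change by at most one do not change at all.\<close>

lemma red_count_even:
  assumes "\<And>i. i < m \<Longrightarrow> red_count us R i \<noteq> 1 \<and> red_count us R i \<noteq> 3"
  shows "\<exists>c\<in>{0, 2, 4}. \<forall>i<m. red_count us R i = c"
proof -
  have ev: "red_count us R i \<in> {0, 2, 4}" if "i < m" for i
    using assms[OF that] red_count_le[of us R i] by auto
  have "red_count us R i = red_count us R 0" if "i < m" for i
    using that
  proof (induction i)
    case (Suc i)
    then show ?case using ev[of i] ev[of "Suc i"] red_count_step[of us R i] by auto
  qed simp
  moreover have "m = 0 \<or> red_count us R 0 \<in> {0, 2, 4}" using ev by blast
  ultimately show ?thesis by blast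
qed

lemma red_count_0:
  assumes "i < length us" "red_count us R i = 0"
  shows "us!i \<notin> R"
  using assms unfolding red_count_def sum_lessThan_4 by (simp add: of_bool_def split: if_splits)

lemma red_count_4:
  assumes "i < length us" "red_count us R i = 4"
  shows "us!i \<in> R"
  using assms unfolding red_count_def sum_lessThan_4 by (simp add: of_bool_def split: if_splits)

lemma red_count_corner:
  assumes "4 \<le> length us"
  shows "red_count us R (length us - 2) =
      of_bool (us!(length us - 2) \<in> R) + of_bool (us!(length us - 1) \<in> R) + of_bool (us!0 \<in> R) + of_bool (us!1 \<in> R)"
    and "red_count us R (length us - 1) =
      of_bool (us!(length us - 1) \<in> R) + of_bool (us!0 \<in> R) + of_bool (us!1 \<in> R) + of_bool (us!2 \<in> R)"
    and "red_count us R 0 = of_bool (us!0 \<in> R) + of_bool (us!1 \<in> R) + of_bool (us!2 \<in> R) + of_bool (us!3 \<in> R)"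
proof -
  let ?m = "length us"
  have "(?m - 2 + 1) mod ?m = ?m - 1" "(?m - 2 + 2) mod ?m = 0" "(?m - 2 + 3) mod ?m = 1"
    "(?m - 1 + 1) mod ?m = 0" "(?m - 1 + 2) mod ?m = 1" "(?m - 1 + 3) mod ?m = 2"
    using assms by (auto simp: mod_if)
  then show "red_count us R (?m - 2) =
      of_bool (us!(?m - 2) \<in> R) + of_bool (us!(?m - 1) \<in> R) + of_bool (us!0 \<in> R) + of_bool (us!1 \<in> R)"
    "red_count us R (?m - 1) =
      of_bool (us!(?m - 1) \<in> R) + of_bool (us!0 \<in> R) + of_bool (us!1 \<in> R) + of_bool (us!2 \<in> R)"
    "red_count us R 0 = of_bool (us!0 \<in> R) + of_bool (us!1 \<in> R) + of_bool (us!2 \<in> R) + of_bool (us!3 \<in> R)"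
    unfolding red_count_def sum_lessThan_4 using assms by (simp_all add: numeral_2_eq_2)
qed

text \<open>Blue is expressed as not being in \<open>R\<close>, so the notion is symmetric in the
  colours; the centre may have either one.\<close>

definition peel :: "(real^2) set \<Rightarrow> (real^2) set \<Rightarrow> (real^2) set \<Rightarrow> real^2 \<Rightarrow> bool" where
  "peel X R S c \<longleftrightarrow> S \<subseteq> X \<and> c \<in> S \<and> card S = 4 \<and> (\<forall>z\<in>S - {c}. (z \<in> R) \<noteq> (c \<in> R)) \<and> unobstructed X S c"

lemma four_bools:
  fixes b :: "nat \<Rightarrow> bool"
  shows "(\<Sum>k<4. of_bool (b k)) = (1::nat) \<Longrightarrow> \<exists>k<4. b k \<and> (\<forall>l<4. l \<noteq> k \<longrightarrow> \<not> b l)"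
    and "(\<Sum>k<4. of_bool (b k)) = (3::nat) \<Longrightarrow> \<exists>k<4. \<not> b k \<and> (\<forall>l<4. l \<noteq> k \<longrightarrow> b l)"
proof -
  have e: "(\<exists>k<4. P k) \<longleftrightarrow> P 0 \<or> P 1 \<or> P 2 \<or> P 3" for P :: "nat \<Rightarrow> bool"
    by (simp add: numeral_eq_Suc less_Suc_eq) blast
  have a: "(\<forall>k<4. P k) \<longleftrightarrow> P 0 \<and> P 1 \<and> P 2 \<and> P 3" for P :: "nat \<Rightarrow> bool"
    by (simp add: numeral_eq_Suc less_Suc_eq) blast
  show "(\<Sum>k<4. of_bool (b k)) = (1::nat) \<Longrightarrow> \<exists>k<4. b k \<and> (\<forall>l<4. l \<noteq> k \<longrightarrow> \<not> b l)"
    unfolding sum_lessThan_4 e a by (cases "b 0"; cases "b 1"; cases "b 2"; cases "b 3") simp_all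
  show "(\<Sum>k<4. of_bool (b k)) = (3::nat) \<Longrightarrow> \<exists>k<4. \<not> b k \<and> (\<forall>l<4. l \<noteq> k \<longrightarrow> b l)"
    unfolding sum_lessThan_4 e a by (cases "b 0"; cases "b 1"; cases "b 2"; cases "b 3") simp_all
qed

lemma cyclic_interval_window:
  assumes "i < m" "4 \<le> m"
  shows "cyclic_interval m ((\<lambda>k. (i + k) mod m) ` {..<4})" "inj_on (\<lambda>k. (i + k) mod m) {..<4}"
proof -
  show "inj_on (\<lambda>k. (i + k) mod m) {..<4}"
  proof (rule inj_onI)
    fix x y assume h: "x \<in> {..<4}" "y \<in> {..<4}" "(i + x) mod m = (i + y) mod m"
    then show "x = y" using assms by (auto simp: mod_if split: if_splits)
  qed
  show "cyclic_interval m ((\<lambda>k. (i + k) mod m) ` {..<4})"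
  proof (cases "i + 4 \<le> m")
    case True
    have "(\<lambda>k. (i + k) mod m) ` {..<4} = (+) i ` {..<4}" using True by (intro image_cong) auto
    also have "\<dots> = {i..<i + 4}" by (simp add: lessThan_atLeast0 add.commute)
    finally show ?thesis using True unfolding cyclic_interval_def by auto
  next
    case False
    \<comment> \<open>A window that runs past the end is the complement of the gap between its two
      pieces.\<close>
    have "(\<lambda>k. (i + k) mod m) ` {..<4} = {..<m} - {i + 4 - m..<i}"
    proof (intro set_eqI iffI)
      fix x assume "x \<in> (\<lambda>k. (i + k) mod m) ` {..<4}"
      then obtain k where k: "k < 4" "x = (i + k) mod m" by auto
      then show "x \<in> {..<m} - {i + 4 - m..<i}"
        using assms False by (cases "i + k < m") (auto simp: mod_if)
    next
      fix x assume x: "x \<in> {..<m} - {i + 4 - m..<i}"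
      show "x \<in> (\<lambda>k. (i + k) mod m) ` {..<4}"
      proof (cases "i \<le> x")
        case True
        then show ?thesis using x False by (intro image_eqI[of _ _ "x - i"]) auto
      next
        case False
        then have "x < i + 4 - m" using x by auto
        then show ?thesis using assms by (intro image_eqI[of _ _ "x + m - i"]) auto
      qed
    qed
    then show ?thesis unfolding cyclic_interval_def by auto
  qed
qed

text \<open>The point of the minority colour is the centre. As the star stays within one chain, only
  chords of this chain have to be separated from it.\<close>

lemma window_peel:
  assumes F: "facing_chains C1 C2" and n: "card (C1 \<union> C2) \<ge> 5"
    and us: "distinct us" "set us = C1" "noncross_list us" and m: "4 \<le> length us" "i < length us"
    and cnt: "red_count us R i = 1 \<or> red_count us R i = 3"
  obtains S c where "peel (C1 \<union> C2) R S c" "S \<subseteq> C1" "c \<in> R \<longleftrightarrow> red_count us R i = 1"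
proof -
  define w where "w k = (i + k) mod length us" for k
  obtain k where k: "k < 4" "us!(w k) \<in> R \<longleftrightarrow> red_count us R i = 1"
    "\<And>l. l < 4 \<Longrightarrow> l \<noteq> k \<Longrightarrow> (us!(w l) \<in> R) \<noteq> (us!(w k) \<in> R)"
    using four_bools[of "\<lambda>k. us!(w k) \<in> R"] cnt unfolding red_count_def w_def[symmetric]
    by (metis (no_types, lifting) numeral_eq_one_iff semiring_norm(86))
  define I where "I = w ` {..<4}"
  have I: "cyclic_interval (length us) I" and inj: "inj_on w {..<4}"
    using cyclic_interval_window[OF m(2,1)] unfolding I_def w_def by auto
  have wl: "w l < length us" for l unfolding w_def using m by (intro mod_less_divisor) auto
  define S where "S = (!) us ` I"
  define c where "c = us!(w k)"
  have disj: "C1 \<inter> C2 = {}" using F unfolding facing_chains_def by blast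
  have SC: "S \<subseteq> C1" using us(2) wl by (auto simp: S_def I_def)
  have cS: "c \<in> S" using k by (auto simp: S_def I_def c_def)
  have "unobstructed (C1 \<union> C2) S c"
  proof (rule unobstructedI[OF F n cS])
    show "separated C1 S"
      using separated_cyclic_interval[OF us(3,1) I, of S] SC us(2) by (simp add: S_def Int_absorb2)
    show "separated C2 S" using SC disj unfolding separated_def by blast
  qed (use SC disj in auto)
  moreover have "card S = 4"
  proof -
    have "inj_on ((!) us) I" using us(1) wl by (auto simp: inj_on_def nth_eq_iff_index_eq I_def)
    then have "card S = card I" by (simp add: S_def card_image)
    then show ?thesis using inj by (simp add: I_def card_image)
  qed
  moreover have "(z \<in> R) \<noteq> (c \<in> R)" if z: "z \<in> S - {c}" for z
  proof -
    obtain l where l: "l < 4" "z = us!(w l)" using z by (auto simp: S_def I_def)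
    then have "l \<noteq> k" using z by (auto simp: c_def)
    then show ?thesis using k(3) l by (simp add: c_def)
  qed
  ultimately have "peel (C1 \<union> C2) R S c" using SC cS unfolding peel_def by blast
  then show ?thesis using that SC k(2) by (simp add: c_def)
qed

section \<open>Stars at the common end of the chains\<close>

lemma corner_peel:
  assumes F: "facing_chains C1 C2" and n: "card (C1 \<union> C2) \<ge> 5" and O: "chain_order C1 C2 us ls s"
    and IJ: "cyclic_interval (length us) I" "cyclic_interval (length ls) J" "card I + card J = 4"
    and S: "S = (!) us ` I \<union> (!) ls ` J" and c: "c \<in> S"
    and ok: "\<And>i j. i \<in> I \<Longrightarrow> j \<in> J \<Longrightarrow> c = us!i \<or> c = ls!j \<Longrightarrow>
      {..i} \<subseteq> I \<and> {..j} \<subseteq> J \<and> (j = 0 \<longrightarrow> i < s) \<or> j = 0 \<and> s \<le> i \<and> {i..<length us} \<subseteq> I"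
    and col: "\<And>z. z \<in> S \<Longrightarrow> z \<noteq> c \<Longrightarrow> (z \<in> R) \<noteq> (c \<in> R)"
  shows "peel (C1 \<union> C2) R S c \<and> card (S \<inter> C1) = card I \<and> card (S \<inter> C2) = card J"
proof -
  have sets: "set us = C1" "set ls = C2" "distinct us" "distinct ls"
    using O unfolding chain_order_def by auto
  have il: "I \<subseteq> {..<length us}" "J \<subseteq> {..<length ls}" using IJ by (auto simp: cyclic_interval_def)
  have sub: "(!) us ` I \<subseteq> C1" "(!) ls ` J \<subseteq> C2" using il sets nth_mem by blast+
  have disj: "C1 \<inter> C2 = {}" using F unfolding facing_chains_def by blast
  have S1: "S \<inter> C1 = (!) us ` I" and S2: "S \<inter> C2 = (!) ls ` J" using S sub disj by auto
  have "inj_on ((!) us) I" "inj_on ((!) ls) J"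
    using sets il by (auto simp: inj_on_def nth_eq_iff_index_eq subset_iff)
  then have cards: "card (S \<inter> C1) = card I" "card (S \<inter> C2) = card J"
    unfolding S1 S2 by (simp_all add: card_image)
  have fin: "finite C1" "finite C2" using F unfolding facing_chains_def by auto
  have "S = S \<inter> C1 \<union> S \<inter> C2" using S sub by blast
  then have "card S = card (S \<inter> C1) + card (S \<inter> C2)"
    using card_Un_disjoint[of "S \<inter> C1" "S \<inter> C2"] fin disj by auto
  then have "card S = 4" using cards IJ by simp
  moreover have "unobstructed (C1 \<union> C2) S c"
    using chain_order_unobstructed[OF F n O IJ(1,2) S c] ok by blast
  moreover have "S \<subseteq> C1 \<union> C2" using S sub by blast
  ultimately show ?thesis using cards c col unfolding peel_def by blast
qed

lemma corner_peel_u: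
  assumes F: "facing_chains C1 C2" and n: "card (C1 \<union> C2) \<ge> 5" and O: "chain_order C1 C2 us ls s"
    and IJ: "cyclic_interval (length us) I" "cyclic_interval (length ls) J" "card I + card J = 4"
    and i: "i \<in> I"
    and ok: "\<And>j. j \<in> J \<Longrightarrow>
      {..i} \<subseteq> I \<and> {..j} \<subseteq> J \<and> (j = 0 \<longrightarrow> i < s) \<or> j = 0 \<and> s \<le> i \<and> {i..<length us} \<subseteq> I"
    and col: "\<And>k. k \<in> I \<Longrightarrow> k \<noteq> i \<Longrightarrow> (us!k \<in> R) \<noteq> (us!i \<in> R)" "\<And>j. j \<in> J \<Longrightarrow> (ls!j \<in> R) \<noteq> (us!i \<in> R)"
  shows "\<exists>S. peel (C1 \<union> C2) R S (us!i) \<and> card (S \<inter> C1) = card I \<and> card (S \<inter> C2) = card J"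
proof (rule exI, rule corner_peel[OF F n O IJ refl])
  have sets: "set us = C1" "set ls = C2" "distinct us" "C1 \<inter> C2 = {}"
    using O F unfolding chain_order_def facing_chains_def by auto
  have il: "I \<subseteq> {..<length us}" "J \<subseteq> {..<length ls}" using IJ by (auto simp: cyclic_interval_def)
  show "us!i \<in> (!) us ` I \<union> (!) ls ` J" using i by blast
  show "(z \<in> R) \<noteq> (us!i \<in> R)" if "z \<in> (!) us ` I \<union> (!) ls ` J" "z \<noteq> us!i" for z
    using that col by blast
  fix i' j assume h: "i' \<in> I" "j \<in> J" "us!i = us!i' \<or> us!i = ls!j"
  have lt: "i < length us" "i' < length us" "j < length ls" using il i h by auto
  have "us!i \<in> C1" "ls!j \<in> C2" using nth_mem[OF lt(1)] nth_mem[OF lt(3)] by (simp_all add: sets)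
  then have "us!i = us!i'" using h(3) sets(4) by auto
  then have "i' = i" using sets(3) lt by (simp add: nth_eq_iff_index_eq)
  then show "{..i'} \<subseteq> I \<and> {..j} \<subseteq> J \<and> (j = 0 \<longrightarrow> i' < s) \<or> j = 0 \<and> s \<le> i' \<and> {i'..<length us} \<subseteq> I"
    using ok h by blast
qed

lemma corner_peel_l:
  assumes F: "facing_chains C1 C2" and n: "card (C1 \<union> C2) \<ge> 5" and O: "chain_order C1 C2 us ls s"
    and IJ: "cyclic_interval (length us) I" "cyclic_interval (length ls) J" "card I + card J = 4"
    and j: "j \<in> J"
    and ok: "\<And>i. i \<in> I \<Longrightarrow>
      {..i} \<subseteq> I \<and> {..j} \<subseteq> J \<and> (j = 0 \<longrightarrow> i < s) \<or> j = 0 \<and> s \<le> i \<and> {i..<length us} \<subseteq> I"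
    and col: "\<And>k. k \<in> J \<Longrightarrow> k \<noteq> j \<Longrightarrow> (ls!k \<in> R) \<noteq> (ls!j \<in> R)" "\<And>i. i \<in> I \<Longrightarrow> (us!i \<in> R) \<noteq> (ls!j \<in> R)"
  shows "\<exists>S. peel (C1 \<union> C2) R S (ls!j) \<and> card (S \<inter> C1) = card I \<and> card (S \<inter> C2) = card J"
proof (rule exI, rule corner_peel[OF F n O IJ refl])
  have sets: "set us = C1" "set ls = C2" "distinct ls" "C1 \<inter> C2 = {}"
    using O F unfolding chain_order_def facing_chains_def by auto
  have il: "I \<subseteq> {..<length us}" "J \<subseteq> {..<length ls}" using IJ by (auto simp: cyclic_interval_def)
  show "ls!j \<in> (!) us ` I \<union> (!) ls ` J" using j by blast
  show "(z \<in> R) \<noteq> (ls!j \<in> R)" if "z \<in> (!) us ` I \<union> (!) ls ` J" "z \<noteq> ls!j" for z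
    using that col by blast
  fix i j' assume h: "i \<in> I" "j' \<in> J" "ls!j = us!i \<or> ls!j = ls!j'"
  have lt: "i < length us" "j' < length ls" "j < length ls" using il j h by auto
  have "us!i \<in> C1" "ls!j \<in> C2" using nth_mem[OF lt(1)] nth_mem[OF lt(3)] by (simp_all add: sets)
  then have "ls!j = ls!j'" using h(3) sets(4) by auto
  then have "j' = j" using sets(3) lt by (simp add: nth_eq_iff_index_eq)
  then show "{..i} \<subseteq> I \<and> {..j'} \<subseteq> J \<and> (j' = 0 \<longrightarrow> i < s) \<or> j' = 0 \<and> s \<le> i \<and> {i..<length us} \<subseteq> I"
    using ok h by blast
qed

lemma cyclic_interval_corner:
  "1 \<le> m \<Longrightarrow> cyclic_interval m {0}"
  "2 \<le> m \<Longrightarrow> cyclic_interval m {0, 1}"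
  "3 \<le> m \<Longrightarrow> cyclic_interval m {0, 1, 2}"
  "3 \<le> m \<Longrightarrow> cyclic_interval m {m - 1, 0, 1}"
  "3 \<le> m \<Longrightarrow> cyclic_interval m {m - 2, m - 1, 0}"
proof -
  show "cyclic_interval m {0}" if "1 \<le> m"
    unfolding cyclic_interval_def by (intro conjI exI[of _ 0] exI[of _ 1] disjI1) (use that in auto)
  show "cyclic_interval m {0, 1}" if "2 \<le> m"
    unfolding cyclic_interval_def by (intro conjI exI[of _ 0] exI[of _ 2] disjI1) (use that in auto)
  show "cyclic_interval m {0, 1, 2}" if "3 \<le> m"
    unfolding cyclic_interval_def by (intro conjI exI[of _ 0] exI[of _ 3] disjI1) (use that in auto)
  show "cyclic_interval m {m - 1, 0, 1}" if "3 \<le> m"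
    unfolding cyclic_interval_def by (intro conjI exI[of _ 2] exI[of _ "m - 1"] disjI2) (use that in auto)
  show "cyclic_interval m {m - 2, m - 1, 0}" if "3 \<le> m"
    unfolding cyclic_interval_def by (intro conjI exI[of _ 1] exI[of _ "m - 2"] disjI2) (use that in auto)
qed

text \<open>\<open>x\<close>, \<open>y\<close>, \<open>a\<close>, \<open>b\<close>, \<open>c\<close>
  are the colours at positions \<open>m - 2\<close>, \<open>m - 1\<close>, 0, 1, 2 of a chain and
  \<open>l\<close> is that of the facing end point. Each case names a centre that differs from two
  neighbours and from \<open>l\<close>. The last case offers both \<open>c\<close> and
  \<open>y\<close>, because which of them is usable may depend on \<open>s\<close>.\<close>

lemma zero_sum_cases:
  fixes x y a b c l :: bool
  assumes "of_bool x + of_bool y + of_bool a + of_bool b = (2::nat)"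
    "of_bool y + of_bool a + of_bool b + of_bool c = (2::nat)"
  obtains "y \<noteq> a" "b \<noteq> a" "l \<noteq> a" | "a \<noteq> b" "c \<noteq> b" "l \<noteq> b" | "y \<noteq> b" "a \<noteq> b" "l \<noteq> b"
    | "b \<noteq> a" "c \<noteq> a" "l \<noteq> a" | "x \<noteq> a" "y \<noteq> a" "l \<noteq> a"
    | "a \<noteq> c" "b \<noteq> c" "l \<noteq> c" "a \<noteq> y" "b \<noteq> y" "l \<noteq> y"
  using assms by (cases x; cases y; cases a; cases b; cases c; cases l) simp_all

text \<open>Three points around position 0 of \<open>us\<close> and the end point
  \<open>ls!0\<close>, with the centre on \<open>us\<close>. Centres at position 1 are the reason
  for the assumption on \<open>s\<close>.\<close>

lemma zero_sum_peel_u: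
  assumes F: "facing_chains C1 C2" and n: "card (C1 \<union> C2) \<ge> 5" and O: "chain_order C1 C2 us ls s"
    and m: "4 \<le> length us" and l: "1 \<le> length ls" and s: "s = length us \<or> 2 \<le> s"
    and cnt: "red_count us R (length us - 2) = 2" "red_count us R (length us - 1) = 2"
  shows "\<exists>S c. peel (C1 \<union> C2) R S c \<and> card (S \<inter> C1) = 3 \<and> card (S \<inter> C2) = 1"
proof -
  let ?m = "length us"
  have s1: "1 < s" "s \<le> ?m" using s m O unfolding chain_order_def by auto
  have m3: "3 \<le> ?m" using m by simp
  note ci = cyclic_interval_corner(1)[OF l] cyclic_interval_corner(3-5)[OF m3]
  have cards: "card {0, 1, 2::nat} = 3" "card {?m - 1, 0, 1} = 3" "card {?m - 2, ?m - 1, 0} = 3"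
    using m by (auto simp: card_insert_if)
  note U = corner_peel_u[OF F n O]
  let ?x = "us!(?m - 2) \<in> R" and ?y = "us!(?m - 1) \<in> R" and ?a = "us!0 \<in> R" and ?b = "us!1 \<in> R"
    and ?c = "us!2 \<in> R" and ?l = "ls!0 \<in> R"
  have two: "of_bool ?x + of_bool ?y + of_bool ?a + of_bool ?b = (2::nat)"
    "of_bool ?y + of_bool ?a + of_bool ?b + of_bool ?c = (2::nat)"
    using cnt unfolding red_count_corner[OF m] .
  have fin: ?thesis if "\<exists>S. peel (C1 \<union> C2) R S c \<and> card (S \<inter> C1) = card I \<and> card (S \<inter> C2) = card {0::nat}"
      "card I = 3" for c and I :: "nat set"
    using that by auto
  show ?thesis
  proof (cases rule: zero_sum_cases[OF two, of ?l])
    case 1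
    show ?thesis
      by (rule fin[OF _ cards(2)], rule U[OF ci(3,1), of 0])
          (use 1 s1 cards in auto)
  next
    case 2
    show ?thesis
      by (rule fin[OF _ cards(1)], rule U[OF ci(2,1), of 1])
          (use 2 s1 cards in auto)
  next
    case 3
    show ?thesis
      by (rule fin[OF _ cards(2)], rule U[OF ci(3,1), of 1])
          (use 3 s1 cards in auto)
  next
    case 4
    show ?thesis
      by (rule fin[OF _ cards(1)], rule U[OF ci(2,1), of 0])
          (use 4 s1 cards in auto)
  next
    case 5
    show ?thesis
      by (rule fin[OF _ cards(3)], rule U[OF ci(4,1), of 0])
          (use 5 s1 cards in auto)
  next
    case 6
    show ?thesis
    \<comment> \<open>The edge from \<open>us!2\<close> to \<open>ls!0\<close> is safe if
      \<open>ls!0\<close> is first for all of \<open>us\<close>; otherwise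
      \<open>us!(?m - 1)\<close> sees it last, and no point of \<open>us\<close> follows.\<close>
    proof (cases "s = ?m")
      case True
      show ?thesis
        by (rule fin[OF _ cards(1)], rule U[OF ci(2,1), of 2])
          (use 6 True m cards in auto)
    next
      case False
      show ?thesis
        by (rule fin[OF _ cards(2)], rule U[OF ci(3,1), of "?m - 1"])
          (use 6 False s1 m cards in auto)
    qed
  qed
qed

text \<open>Here the only point of the other chain is \<open>us!0\<close>, from which
  \<open>ls!0\<close> is always first; so \<open>0 < s\<close> suffices and \<open>ls!2\<close>
  always works in the last case.\<close>

lemma zero_sum_peel_l:
  assumes F: "facing_chains C1 C2" and n: "card (C1 \<union> C2) \<ge> 5" and O: "chain_order C1 C2 us ls s"
    and m: "1 \<le> length us" and l: "4 \<le> length ls"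
    and cnt: "red_count ls R (length ls - 2) = 2" "red_count ls R (length ls - 1) = 2"
  shows "\<exists>S c. peel (C1 \<union> C2) R S c \<and> card (S \<inter> C1) = 1 \<and> card (S \<inter> C2) = 3"
proof -
  let ?n = "length ls"
  have s1: "0 < s" using O unfolding chain_order_def by auto
  have n3: "3 \<le> ?n" using l by simp
  note ci = cyclic_interval_corner(1)[OF m] cyclic_interval_corner(3-5)[OF n3]
  have cards: "card {0, 1, 2::nat} = 3" "card {?n - 1, 0, 1} = 3" "card {?n - 2, ?n - 1, 0} = 3"
    using l by (auto simp: card_insert_if)
  note L = corner_peel_l[OF F n O]
  let ?x = "ls!(?n - 2) \<in> R" and ?y = "ls!(?n - 1) \<in> R" and ?a = "ls!0 \<in> R" and ?b = "ls!1 \<in> R"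
    and ?c = "ls!2 \<in> R" and ?l = "us!0 \<in> R"
  have two: "of_bool ?x + of_bool ?y + of_bool ?a + of_bool ?b = (2::nat)"
    "of_bool ?y + of_bool ?a + of_bool ?b + of_bool ?c = (2::nat)"
    using cnt unfolding red_count_corner[OF l] .
  have fin: ?thesis if "\<exists>S. peel (C1 \<union> C2) R S c \<and> card (S \<inter> C1) = card {0::nat} \<and> card (S \<inter> C2) = card I"
      "card I = 3" for c and I :: "nat set"
    using that by auto
  show ?thesis
  proof (cases rule: zero_sum_cases[OF two, of ?l])
    case 1
    show ?thesis
      by (rule fin[OF _ cards(2)], rule L[OF ci(1,3), of 0]) (use 1 s1 cards in auto)
  next
    case 2
    show ?thesis
      by (rule fin[OF _ cards(1)], rule L[OF ci(1,2), of 1]) (use 2 s1 cards in auto)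
  next
    case 3
    show ?thesis
      by (rule fin[OF _ cards(2)], rule L[OF ci(1,3), of 1]) (use 3 s1 cards in auto)
  next
    case 4
    show ?thesis
      by (rule fin[OF _ cards(1)], rule L[OF ci(1,2), of 0]) (use 4 s1 cards in auto)
  next
    case 5
    show ?thesis
      by (rule fin[OF _ cards(3)], rule L[OF ci(1,4), of 0]) (use 5 s1 cards in auto)
  next
    case 6
    show ?thesis
      by (rule fin[OF _ cards(1)], rule L[OF ci(1,2), of 2]) (use 6 s1 cards in auto)
  qed
qed

lemma cross_claw_peel:
  assumes F: "facing_chains C1 C2" and n: "card (C1 \<union> C2) \<ge> 5" and O: "chain_order C1 C2 us ls s"
    and m: "1 \<le> length us" and l: "3 \<le> length ls"
    and col: "\<And>j. j < 3 \<Longrightarrow> (ls!j \<in> R) \<noteq> (us!0 \<in> R)"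
  shows "\<exists>S. peel (C1 \<union> C2) R S (us!0) \<and> card (S \<inter> C1) = 1 \<and> card (S \<inter> C2) = 3"
proof -
  have s1: "0 < s" using O unfolding chain_order_def by auto
  have "\<exists>S. peel (C1 \<union> C2) R S (us!0) \<and> card (S \<inter> C1) = card {0::nat} \<and> card (S \<inter> C2) = card {0, 1, 2::nat}"
    by (rule corner_peel_u[OF F n O cyclic_interval_corner(1)[OF m] cyclic_interval_corner(3)[OF l]])
      (use s1 col in auto)
  then show ?thesis by (simp add: numeral_3_eq_3)
qed

section \<open>Existence of a star to peel off\<close>

lemma even_if_sum_red_count_2:
  assumes "distinct us" "us \<noteq> []" "\<And>i. i < length us \<Longrightarrow> red_count us R i = 2"
  shows "even (length us)"
proof -
  have "(\<Sum>i<length us. red_count us R i) = 2 * length us" using assms(3) by simp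
  then have "2 * length us = 4 * card (set us \<inter> R)" using sum_red_count[OF assms(1,2), of R] by simp
  then have "length us = 2 * card (set us \<inter> R)" by simp
  then show ?thesis by simp
qed

lemma peel_exists_mixed_aux:
  assumes F: "facing_chains C1 C2" and O: "chain_order C1 C2 us ls s"
    and s: "s = length us \<or> 2 \<le> s \<or> length us = 2" and ne: "C2 \<noteq> {}"
    and R: "R \<subseteq> C1 \<union> C2" "card (C1 \<union> C2) = 4 * (g + h)" "card R = 3 * g + h" and gh: "1 \<le> g" "1 \<le> h"
  shows "\<exists>S c. peel (C1 \<union> C2) R S c \<and> ((C1 - S \<noteq> {} \<and> C2 - S \<noteq> {}) \<or> g + h = 2)"
proof (rule ccontr)
  assume "\<not> ?thesis"
  then have none: "C1 - S = {} \<or> C2 - S = {}" "g + h \<noteq> 2" if "peel (C1 \<union> C2) R S c" for S c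
    using that by blast+
  let ?X = "C1 \<union> C2" and ?m = "length us" and ?n = "length ls"
  note F' = facing_chains_sym[OF F]
  have n5: "card ?X \<ge> 5" using R gh by simp
  then have n5': "card (C2 \<union> C1) \<ge> 5" by (simp add: Un_commute)
  have o: "distinct us" "set us = C1" "noncross_list us" "distinct ls" "set ls = C2" "noncross_list ls"
    "0 < s" "s \<le> ?m" using O unfolding chain_order_def by auto
  have fin: "finite C1" "finite C2" and disj: "C1 \<inter> C2 = {}" using F unfolding facing_chains_def by auto
  have cm: "card C1 = ?m" and cn: "card C2 = ?n" using o distinct_card by metis+
  have mn: "?m + ?n = 4 * (g + h)" using R(2) card_Un_disjoint[OF fin disj] cm cn by simp
  have m1: "1 \<le> ?m" using o by simp
  have n1: "1 \<le> ?n" using ne o(5) by (cases ls) auto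
  have nosplit: False if "peel ?X R S c" "card (S \<inter> C1) < ?m" "card (S \<inter> C2) < ?n" for S c
  proof -
    have "C1 - S \<noteq> {}" using that(2) cm by (metis Diff_eq_empty_iff inf.absorb2 less_irrefl)
    moreover have "C2 - S \<noteq> {}" using that(3) cn by (metis Diff_eq_empty_iff inf.absorb2 less_irrefl)
    ultimately show False using none(1)[OF that(1)] by blast
  qed
  \<comment> \<open>A chain of five points survives the removal of a window; for
    \<open>g + h = 2\<close> four points suffice, since the star may then use up the chain.\<close>
  define big where "big k \<longleftrightarrow> 5 \<le> k \<or> 4 \<le> k \<and> g + h = 2" for k :: nat
  have own_u: "red_count us R i \<noteq> 1 \<and> red_count us R i \<noteq> 3" if b: "big ?m" and i: "i < ?m" for i
  proof (rule ccontr)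
    assume "\<not> ?thesis"
    then have "red_count us R i = 1 \<or> red_count us R i = 3" by blast
    then obtain S c where S: "peel ?X R S c" "S \<subseteq> C1"
      using window_peel[OF F n5 o(1-3) _ i] b unfolding big_def by (metis le_trans numeral_le_iff semiring_norm(68,71,72,76))
    then have "5 \<le> ?m" using none(2) b unfolding big_def by blast
    have "card (S \<inter> C1) \<le> card S" using S fin by (intro card_mono) (auto intro: finite_subset)
    also have "\<dots> = 4" using S(1) unfolding peel_def by blast
    finally have "card (S \<inter> C1) < ?m" using \<open>5 \<le> ?m\<close> by simp
    moreover have e: "S \<inter> C2 = {}" using S disj by blast
    have "card (S \<inter> C2) < ?n" unfolding e card.empty using n1 by linarith
    ultimately show False using nosplit[OF S(1)] by blast
  qed
  have own_l: "red_count ls R i \<noteq> 1 \<and> red_count ls R i \<noteq> 3" if b: "big ?n" and i: "i < ?n" for i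
  proof (rule ccontr)
    assume "\<not> ?thesis"
    then have "red_count ls R i = 1 \<or> red_count ls R i = 3" by blast
    then obtain S c where S: "peel ?X R S c" "S \<subseteq> C2"
      using window_peel[OF F' n5' o(4-6) _ i] b unfolding big_def Un_commute[of C2 C1]
      by (metis le_trans numeral_le_iff semiring_norm(68,71,72,76))
    then have "5 \<le> ?n" using none(2) b unfolding big_def by blast
    have "card (S \<inter> C2) \<le> card S" using S fin by (intro card_mono) (auto intro: finite_subset)
    also have "\<dots> = 4" using S(1) unfolding peel_def by blast
    finally have "card (S \<inter> C2) < ?n" using \<open>5 \<le> ?n\<close> by simp
    moreover have e: "S \<inter> C1 = {}" using S disj by blast
    have "card (S \<inter> C1) < ?m" unfolding e card.empty using m1 by linarith
    ultimately show False using nosplit[OF S(1)] by blast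
  qed
  have const_u: "C1 \<subseteq> R \<or> C1 \<inter> R = {}" if b: "big ?m"
  proof -
    have m4: "4 \<le> ?m" using b unfolding big_def by auto
    obtain c where c: "c \<in> {0, 2, 4}" "\<And>i. i < ?m \<Longrightarrow> red_count us R i = c"
      using red_count_even[of ?m us R] own_u[OF b] by blast
    have "c \<noteq> 2"
    proof
      assume c2: "c = 2"
      \<comment> \<open>By parity the other chain has at least two points, so it survives a star
        that takes one of them.\<close>
      have "even ?m" using even_if_sum_red_count_2[of us R] o(1) m4 c c2 by fastforce
      then have "even ?n" using mn by (metis dvd_triv_left even_add even_mult_iff even_numeral)
      then have "2 \<le> ?n" using n1 by (cases "?n = 1") auto
      have "s = ?m \<or> 2 \<le> s" using s m4 by auto
      then obtain S c where "peel ?X R S c \<and> card (S \<inter> C1) = 3 \<and> card (S \<inter> C2) = 1"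
        using zero_sum_peel_u[OF F n5 O m4 n1] c c2 m4 by fastforce
      then show False using nosplit m4 \<open>2 \<le> ?n\<close> by fastforce
    qed
    then consider "c = 0" | "c = 4" using c(1) by blast
    then show ?thesis
    proof cases
      case 1
      then have "us!i \<notin> R" if "i < ?m" for i using red_count_0[OF that] c(2)[OF that] by blast
      then show ?thesis using o(2) by (metis disjoint_iff in_set_conv_nth)
    next
      case 2
      then have "us!i \<in> R" if "i < ?m" for i using red_count_4[OF that] c(2)[OF that] by blast
      then show ?thesis using o(2) by (metis in_set_conv_nth subsetI)
    qed
  qed
  have const_l: "C2 \<subseteq> R \<or> C2 \<inter> R = {}" if b: "big ?n"
  proof -
    have n4: "4 \<le> ?n" using b unfolding big_def by auto
    obtain c where c: "c \<in> {0, 2, 4}" "\<And>i. i < ?n \<Longrightarrow> red_count ls R i = c"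
      using red_count_even[of ?n ls R] own_l[OF b] by blast
    have "c \<noteq> 2"
    proof
      assume c2: "c = 2"
      have "even ?n" using even_if_sum_red_count_2[of ls R] o(4) n4 c c2 by fastforce
      then have "even ?m" using mn by (metis dvd_triv_left even_add even_mult_iff even_numeral)
      then have "2 \<le> ?m" using m1 by (cases "?m = 1") auto
      obtain S c where "peel ?X R S c \<and> card (S \<inter> C1) = 1 \<and> card (S \<inter> C2) = 3"
        using zero_sum_peel_l[OF F n5 O m1 n4] c c2 n4 by fastforce
      then show False using nosplit n4 \<open>2 \<le> ?m\<close> by fastforce
    qed
    then consider "c = 0" | "c = 4" using c(1) by blast
    then show ?thesis
    proof cases
      case 1
      then have "ls!i \<notin> R" if "i < ?n" for i using red_count_0[OF that] c(2)[OF that] by blast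
      then show ?thesis using o(5) by (metis disjoint_iff in_set_conv_nth)
    next
      case 2
      then have "ls!i \<in> R" if "i < ?n" for i using red_count_4[OF that] c(2)[OF that] by blast
      then show ?thesis using o(5) by (metis in_set_conv_nth subsetI)
    qed
  qed
  have finR: "finite R" using R fin finite_subset by blast
  have cB: "card (?X - R) = g + 3 * h" using R finR by (simp add: card_Diff_subset)
  have bound: "card C \<le> 3 * g + h \<or> card C \<le> g + 3 * h" if "C \<subseteq> R \<or> C \<inter> R = {}" "C \<subseteq> ?X" for C
    using that(1)
  proof
    assume "C \<subseteq> R"
    then show ?thesis using card_mono[OF finR] R(3) by simp
  next
    assume "C \<inter> R = {}"
    then have "C \<subseteq> ?X - R" using that by blast
    then show ?thesis using card_mono[of "?X - R" C] fin cB by simp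
  qed
  \<comment> \<open>A monochromatic chain leaves at least \<open>g + 3 * h\<close> or
    \<open>3 * g + h\<close> points to the other one. Both numbers are at least 4, with equality
    only for \<open>g = h = 1\<close>, which is exactly the exception in \<open>big\<close>.\<close>
  have bigs: "big k" if "k + l = 4 * (g + h)" "l \<le> 3 * g + h \<or> l \<le> g + 3 * h" for k l
    using that gh unfolding big_def by auto
  have "big ?m \<or> big ?n" using mn gh unfolding big_def by auto
  moreover have "big ?n" if "big ?m" using bigs[of ?n ?m] bound[OF const_u[OF that]] cm mn by auto
  moreover have "big ?m" if "big ?n" using bigs[of ?m ?n] bound[OF const_l[OF that]] cn mn by auto
  ultimately have big2: "big ?m" "big ?n" by blast+
  have m4: "4 \<le> ?m" and n4: "4 \<le> ?n" using big2 unfolding big_def by auto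
  have "\<not> (C1 \<subseteq> R \<and> C2 \<subseteq> R)" 
  proof
    assume "C1 \<subseteq> R \<and> C2 \<subseteq> R"
    then have "R = ?X" using R(1) by blast
    then show False using R gh by simp
  qed
  moreover have "\<not> (C1 \<inter> R = {} \<and> C2 \<inter> R = {})"
  proof
    assume "C1 \<inter> R = {} \<and> C2 \<inter> R = {}"
    then have "R = {}" using R(1) by blast
    then show False using R gh by simp
  qed
  ultimately have opp: "C1 \<subseteq> R \<and> C2 \<inter> R = {} \<or> C1 \<inter> R = {} \<and> C2 \<subseteq> R"
    using const_u[OF big2(1)] const_l[OF big2(2)] by blast
  have "0 < ?m" using m4 by linarith
  then have "us!0 \<in> C1" using nth_mem[of 0 us] unfolding o(2) by blast
  moreover have "ls!j \<in> C2" if "j < 3" for j using o(5) n4 nth_mem[of j ls] that by auto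
  ultimately have "(ls!j \<in> R) \<noteq> (us!0 \<in> R)" if "j < 3" for j using opp that by blast
  then obtain S where "peel ?X R S (us!0)" "card (S \<inter> C1) = 1" "card (S \<inter> C2) = 3"
    using cross_claw_peel[OF F n5 O m1, of R] n4 by auto
  then show False using nosplit[of S "us!0"] m4 n4 by simp
qed

lemma peel_exists_single_aux:
  assumes F: "facing_chains C1 C2" and O: "chain_order C1 C2 us ls s"
    and s: "s = length us \<or> 2 \<le> s \<or> length us = 2" and ne: "C2 \<noteq> {}"
    and R: "R \<subseteq> C1 \<union> C2" "card (C1 \<union> C2) = 4 * h" "card R = h" and h: "2 \<le> h"
  shows "\<exists>S c. peel (C1 \<union> C2) R S c \<and> c \<in> R"
proof (rule ccontr)
  assume "\<not> ?thesis"
  then have none: "\<not> (\<exists>S. peel (C1 \<union> C2) R S c)" if "c \<in> R" for c using that by blast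
  let ?X = "C1 \<union> C2" and ?m = "length us" and ?n = "length ls"
  note F' = facing_chains_sym[OF F]
  have n5: "card ?X \<ge> 5" using R h by simp
  then have n5': "card (C2 \<union> C1) \<ge> 5" by (simp add: Un_commute)
  have o: "distinct us" "set us = C1" "noncross_list us" "distinct ls" "set ls = C2" "noncross_list ls"
    "0 < s" "s \<le> ?m" using O unfolding chain_order_def by auto
  have fin: "finite C1" "finite C2" and disj: "C1 \<inter> C2 = {}" using F unfolding facing_chains_def by auto
  have cm: "card C1 = ?m" and cn: "card C2 = ?n" using o distinct_card by metis+
  have mn: "?m + ?n = 4 * h" using R(2) card_Un_disjoint[OF fin disj] cm cn by simp
  have m1: "1 \<le> ?m" using o by simp
  have n1: "1 \<le> ?n" using ne o(5) by (cases ls) auto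
  define r1 r2 where r: "r1 = card (C1 \<inter> R)" "r2 = card (C2 \<inter> R)"
  have "R = (C1 \<inter> R) \<union> (C2 \<inter> R)" using R(1) by blast
  then have "card R = r1 + r2"
    unfolding r using card_Un_disjoint[of "C1 \<inter> R" "C2 \<inter> R"] fin disj by (metis Int_assoc Int_commute finite_Int inf_bot_left)
  then have rr: "r1 + r2 = h" using R(3) by simp
  have own_u: "red_count us R i \<noteq> 1" if "4 \<le> ?m" "i < ?m" for i
    using window_peel[OF F n5 o(1-3) that, of R] none by metis
  have own_l: "red_count ls R i \<noteq> 1" if "4 \<le> ?n" "i < ?n" for i
    using window_peel[OF F' n5' o(4-6) that, of R] none unfolding Un_commute[of C2 C1] by metis
  have uC: "us!i \<in> C1" if "i < ?m" for i using nth_mem[OF that] unfolding o(2) .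
  have lC: "ls!i \<in> C2" if "i < ?n" for i using nth_mem[OF that] unfolding o(5) .
  \<comment> \<open>Without a window to peel, a chain with red points has at least two of them in
    each window and is therefore at least half red.\<close>
  have dense_u: "r1 = 0 \<or> ?m \<le> 2 * r1 \<and> (\<forall>i<?m. 2 \<le> red_count us R i)" if m4: "4 \<le> ?m"
  proof -
    have ne: "us \<noteq> []" using m4 by auto
    have sum: "(\<Sum>i<?m. red_count us R i) = 4 * r1"
      using sum_red_count[OF o(1) ne] unfolding r o(2) .
    from red_count_no_one[of ?m us R, OF own_u[OF m4]] show ?thesis
    proof
      assume "\<forall>i<?m. red_count us R i = 0"
      then show ?thesis using sum by simp
    next
      assume a: "\<forall>i<?m. 2 \<le> red_count us R i"
      have "(\<Sum>i<?m. 2) \<le> (\<Sum>i<?m. red_count us R i)" using a by (intro sum_mono) auto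
      then show ?thesis using a sum by simp
    qed
  qed
  have dense_l: "r2 = 0 \<or> ?n \<le> 2 * r2 \<and> (\<forall>i<?n. 2 \<le> red_count ls R i)" if n4: "4 \<le> ?n"
  proof -
    have ne: "ls \<noteq> []" using n4 by auto
    have sum: "(\<Sum>i<?n. red_count ls R i) = 4 * r2"
      using sum_red_count[OF o(4) ne] unfolding r o(5) .
    from red_count_no_one[of ?n ls R, OF own_l[OF n4]] show ?thesis
    proof
      assume "\<forall>i<?n. red_count ls R i = 0"
      then show ?thesis using sum by simp
    next
      assume a: "\<forall>i<?n. 2 \<le> red_count ls R i"
      have "(\<Sum>i<?n. 2) \<le> (\<Sum>i<?n. red_count ls R i)" using a by (intro sum_mono) auto
      then show ?thesis using a sum by simp
    qed
  qed
  note U = corner_peel_u[OF F n5 O] and L = corner_peel_l[OF F n5 O] and ci = cyclic_interval_corner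
  show False
  proof (cases "r1 = 0")
    case True
    then have blue: "us!i \<notin> R" if "i < ?m" for i
      using uC[OF that] fin unfolding r by auto
    have r2: "r2 = h" using rr True by simp
    \<comment> \<open>The other chain is at least half red or has at most three points, and only a
      quarter of all points is red.\<close>
    have m3: "4 \<le> ?m"
    proof (cases "4 \<le> ?n")
      case True
      then show ?thesis using dense_l r2 h mn by auto
    next
      case False
      then show ?thesis using mn h by auto
    qed
    have s2: "1 < s" using s m3 o(7,8) by auto
    have n2: "2 \<le> ?n" using r2 h fin card_mono[of C2 "C2 \<inter> R"] unfolding r cn by auto
    have "0 < ?m" "1 < ?m" "2 < ?m" "?m - 1 < ?m" using m3 by linarith+
    then have blue': "us!0 \<notin> R" "us!1 \<notin> R" "us!2 \<notin> R" "us!(?m - 1) \<notin> R" using blue by blast+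
    \<comment> \<open>The points \<open>ls!0\<close>, \<open>ls!1\<close>, \<open>ls!2\<close> are
      blue: a red one among them could be joined to all earlier points of \<open>ls\<close> and to
      as many blue points at the end of \<open>us\<close> as are missing.\<close>
    have l0: "ls!0 \<notin> R"
    proof
      assume a: "ls!0 \<in> R"
      show False
      proof (cases "s = ?m")
        case True
        have "\<exists>S. peel ?X R S (ls!0) \<and> card (S \<inter> C1) = card {0, 1, 2::nat} \<and> card (S \<inter> C2) = card {0::nat}"
          by (rule L[OF ci(3) ci(1)]) (use True m3 n1 a blue' in auto)
        then show False using none[OF a] by blast
      next
        case False
        have "\<exists>S. peel ?X R S (ls!0) \<and> card (S \<inter> C1) = card {?m - 1, 0, 1} \<and> card (S \<inter> C2) = card {0::nat}"
          by (rule L[OF ci(4) ci(1)]) (use False s2 o(8) m3 n1 a blue' in \<open>auto simp: card_insert_if\<close>)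
        then show False using none[OF a] by blast
      qed
    qed
    have l1: "ls!1 \<notin> R"
    proof
      assume a: "ls!1 \<in> R"
      have "\<exists>S. peel ?X R S (ls!1) \<and> card (S \<inter> C1) = card {0, 1::nat} \<and> card (S \<inter> C2) = card {0, 1::nat}"
        by (rule L[OF ci(2) ci(2)]) (use s2 m3 n2 a l0 blue' in auto)
      then show False using none[OF a] by blast
    qed
    have n3: "3 \<le> ?n"
    proof (rule ccontr)
      assume "\<not> 3 \<le> ?n"
      then have "?n = 2" using n2 by simp
      have "C2 \<inter> R = {}"
      proof (rule ccontr)
        assume "C2 \<inter> R \<noteq> {}"
        then obtain i where "i < 2" "ls!i \<in> R" using o(5) \<open>?n = 2\<close> by (metis Int_iff equals0I in_set_conv_nth)
        then show False using l0 l1 by (auto simp: less_2_cases_iff)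
      qed
      then show False using r2 h unfolding r by simp
    qed
    have l2: "ls!2 \<notin> R"
    proof
      assume a: "ls!2 \<in> R"
      have "\<exists>S. peel ?X R S (ls!2) \<and> card (S \<inter> C1) = card {0::nat} \<and> card (S \<inter> C2) = card {0, 1, 2::nat}"
        by (rule L[OF ci(1) ci(3)]) (use s2 m3 n3 a l0 l1 blue' in auto)
      then show False using none[OF a] by blast
    qed
    \<comment> \<open>Three blue points in a row contradict two red points in the first window, and
      a chain of only three points would have no red point.\<close>
    show False
    proof (cases "4 \<le> ?n")
      case True
      moreover have "0 < ?n" "r2 \<noteq> 0" using n3 r2 h by linarith+
      ultimately have "2 \<le> red_count ls R 0" using dense_l by blast
      then show False unfolding red_count_corner(3)[OF True] using l0 l1 l2 by (simp add: of_bool_def split: if_splits)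
    next
      case False
      then have "?n = 3" using n3 by simp
      have "C2 \<inter> R = {}"
      proof (rule ccontr)
        assume "C2 \<inter> R \<noteq> {}"
        then obtain i where "i < 3" "ls!i \<in> R" using o(5) \<open>?n = 3\<close> by (metis Int_iff equals0I in_set_conv_nth)
        then show False using l0 l1 l2 by (auto simp: numeral_3_eq_3 less_Suc_eq numeral_2_eq_2)
      qed
      then show False using r2 h unfolding r by simp
    qed
  next
    case r1: False
    \<comment> \<open>If both chains were at least half red, or one of them and the other had at
      most three points, there would be too many red points; so \<open>C2\<close> is long and
      blue.\<close>
    have n4: "4 \<le> ?n" and r2: "r2 = 0"
    proof -
      have "4 \<le> ?n \<and> r2 = 0"
      proof (cases "4 \<le> ?m")
        case True
        then have m: "?m \<le> 2 * r1" using dense_u r1 by blast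
        then have "4 \<le> ?n" using mn rr h by linarith
        moreover have "\<not> ?n \<le> 2 * r2" using mn rr m h by linarith
        ultimately show ?thesis using dense_l by blast
      next
        case False
        then have "4 \<le> ?n" using mn h by linarith
        moreover have "\<not> ?n \<le> 2 * r2" using mn rr h False by linarith
        ultimately show ?thesis using dense_l by blast
      qed
      then show "4 \<le> ?n" "r2 = 0" by auto
    qed
    then have blue: "ls!i \<notin> R" if "i < ?n" for i
      using lC[OF that] fin unfolding r by auto
    have "0 < ?n" "1 < ?n" "2 < ?n" using n4 by linarith+
    then have blue': "ls!0 \<notin> R" "ls!1 \<notin> R" "ls!2 \<notin> R" using blue by blast+
    have r1h: "r1 = h" using rr r2 by simp
    have m2: "2 \<le> ?m" using r1h h fin card_mono[of C1 "C1 \<inter> R"] unfolding r cm by auto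
    have u0: "us!0 \<notin> R"
    proof
      assume a: "us!0 \<in> R"
      have "\<exists>S. peel ?X R S (us!0) \<and> card (S \<inter> C1) = 1 \<and> card (S \<inter> C2) = 3"
        by (rule cross_claw_peel[OF F n5 O m1]) (use n4 a blue in auto)
      then show False using none[OF a] by blast
    qed
    have m3: "3 \<le> ?m"
    proof (rule ccontr)
      assume "\<not> 3 \<le> ?m"
      then have m: "?m = 2" using m2 by simp
      have "C1 \<inter> R \<subseteq> {us!1}"
      proof
        fix x assume "x \<in> C1 \<inter> R"
        then obtain i where "i < 2" "us!i = x" "x \<in> R" using o(2) m by (metis Int_iff in_set_conv_nth)
        then show "x \<in> {us!1}" using u0 by (auto simp: less_2_cases_iff)
      qed
      then have "r1 \<le> 1" unfolding r using card_mono[of "{us!1}" "C1 \<inter> R"] by simp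
      then show False using r1h h by simp
    qed
    have s2: "1 < s" using s m3 by auto
    have u1: "us!1 \<notin> R"
    proof
      assume a: "us!1 \<in> R"
      have "\<exists>S. peel ?X R S (us!1) \<and> card (S \<inter> C1) = card {0, 1::nat} \<and> card (S \<inter> C2) = card {0, 1::nat}"
        by (rule U[OF ci(2) ci(2)]) (use s2 m3 n4 a u0 blue' in \<open>auto simp: atMost_Suc\<close>)
      then show False using none[OF a] by blast
    qed
    have m4: "4 \<le> ?m"
    proof (rule ccontr)
      assume "\<not> 4 \<le> ?m"
      then have m: "?m = 3" using m3 by simp
      have "C1 \<inter> R \<subseteq> {us!2}"
      proof
        fix x assume "x \<in> C1 \<inter> R"
        then obtain i where "i < 3" "us!i = x" "x \<in> R" using o(2) m by (metis Int_iff in_set_conv_nth)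
        then show "x \<in> {us!2}" using u0 u1 by (auto simp: numeral_3_eq_3 less_Suc_eq numeral_2_eq_2)
      qed
      then have "r1 \<le> 1" unfolding r using card_mono[of "{us!2}" "C1 \<inter> R"] by simp
      then show False using r1h h by simp
    qed
    moreover then have "?m - 1 < ?m" by linarith
    ultimately have "2 \<le> red_count us R (?m - 1)" using dense_u r1 by blast
    \<comment> \<open>Since \<open>us!0\<close> and \<open>us!1\<close> are blue, both other points
      of the window around the end are red. Either could be the centre of a star with
      \<open>us!0\<close>, \<open>us!1\<close>, \<open>ls!0\<close>; the value of \<open>s\<close>
      selects one.\<close>
    then have u2: "us!2 \<in> R" "us!(?m - 1) \<in> R"
      unfolding red_count_corner(2)[OF m4] using u0 u1 by (auto simp: of_bool_def split: if_splits)
    show False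
    proof (cases "s = ?m")
      case True
      have "\<exists>S. peel ?X R S (us!2) \<and> card (S \<inter> C1) = card {0, 1, 2::nat} \<and> card (S \<inter> C2) = card {0::nat}"
        by (rule U[OF ci(3) ci(1)]) (use True m4 n4 u0 u1 u2 blue' in auto)
      then show False using none[OF u2(1)] by blast
    next
      case False
      have "\<exists>S. peel ?X R S (us!(?m - 1)) \<and> card (S \<inter> C1) = card {?m - 1, 0, 1} \<and> card (S \<inter> C2) = card {0::nat}"
        by (rule U[OF ci(4) ci(1)]) (use False o(8) m4 n4 u0 u1 u2 blue' in \<open>auto simp: card_insert_if\<close>)
      then show False using none[OF u2(2)] by blast
    qed
  qed
qed

lemma peel_exists_mixed:
  assumes F: "facing_chains C1 C2" and ne: "C1 \<noteq> {}" "C2 \<noteq> {}"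
    and R: "R \<subseteq> C1 \<union> C2" "card (C1 \<union> C2) = 4 * (g + h)" "card R = 3 * g + h" and gh: "1 \<le> g" "1 \<le> h"
  shows "\<exists>S c. peel (C1 \<union> C2) R S c \<and> ((C1 - S \<noteq> {} \<and> C2 - S \<noteq> {}) \<or> g + h = 2)"
proof -
  have n5: "card (C1 \<union> C2) \<ge> 5" using R gh by simp
  obtain us ls s D1 D2 where D: "(D1, D2) = (C1, C2) \<or> (D1, D2) = (C2, C1)" "chain_order D1 D2 us ls s"
    "s = length us \<or> 2 \<le> s \<or> length us = 2"
    by (rule chain_order_exists[OF F n5 ne])
  have X: "D1 \<union> D2 = C1 \<union> C2" "D2 \<noteq> {}" and FD: "facing_chains D1 D2"
    using D(1) ne F facing_chains_sym by auto
  have "\<exists>S c. peel (D1 \<union> D2) R S c \<and> ((D1 - S \<noteq> {} \<and> D2 - S \<noteq> {}) \<or> g + h = 2)"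
    by (rule peel_exists_mixed_aux[OF FD D(2,3) X(2)]) (use R gh X(1) in simp_all)
  then show ?thesis using D(1) X(1) by auto
qed

lemma peel_exists_single:
  assumes F: "facing_chains C1 C2"
    and R: "R \<subseteq> C1 \<union> C2" "card (C1 \<union> C2) = 4 * h" "card R = h" and h: "2 \<le> h"
  shows "\<exists>S c. peel (C1 \<union> C2) R S c \<and> c \<in> R"
proof (cases "C1 = {} \<or> C2 = {}")
  case False
  have n5: "card (C1 \<union> C2) \<ge> 5" using R h by simp
  obtain us ls s D1 D2 where D: "(D1, D2) = (C1, C2) \<or> (D1, D2) = (C2, C1)" "chain_order D1 D2 us ls s"
    "s = length us \<or> 2 \<le> s \<or> length us = 2"
    by (rule chain_order_exists[OF F n5]) (use False in auto)
  have X: "D1 \<union> D2 = C1 \<union> C2" "D2 \<noteq> {}" and FD: "facing_chains D1 D2"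
    using D(1) False F facing_chains_sym by auto
  have "\<exists>S c. peel (D1 \<union> D2) R S c \<and> c \<in> R"
    by (rule peel_exists_single_aux[OF FD D(2,3) X(2)]) (use R h X(1) in simp_all)
  then show ?thesis using X(1) by simp
next
  case True
  define D where "D = C1 \<union> C2"
  have FD: "facing_chains D {}"
    using True F facing_chains_sym[OF F] by (auto simp: D_def)
  have fin: "finite D" "general_position D" "convex_position D"
    using FD unfolding facing_chains_def by auto
  obtain us where us: "distinct us" "set us = D" "noncross_list us"
    by (rule convex_position_noncross_list[OF fin])
  have len: "length us = 4 * h" using us R(2) distinct_card[OF us(1)] by (simp add: D_def)
  then have ne: "us \<noteq> []" and l4: "4 \<le> length us" using h by auto
  have sum: "(\<Sum>i<length us. red_count us R i) = length us"
  proof -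
    have "set us \<inter> R = R" using us(2) R(1) D_def by blast
    then show ?thesis using sum_red_count[OF us(1) ne, of R] R(3) len by simp
  qed
  \<comment> \<open>The counts sum to the number of windows, so they cannot all be 0 or all be at
    least 2.\<close>
  have "\<exists>i<length us. red_count us R i = 1"
  proof (rule ccontr)
    assume "\<not> ?thesis"
    then have "red_count us R i \<noteq> 1" if "i < length us" for i using that by blast
    then consider "\<forall>i<length us. red_count us R i = 0" | "\<forall>i<length us. 2 \<le> red_count us R i"
      using red_count_no_one[of "length us" us R] by blast
    then show False
    proof cases
      case 1
      then show False using sum ne by simp
    next
      case 2
      then have "(\<Sum>i<length us. 2) \<le> (\<Sum>i<length us. red_count us R i)" by (intro sum_mono) auto
      then show False using sum l4 by simp
    qed
  qed
  then obtain i where i: "i < length us" "red_count us R i = 1" by blast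
  have "5 \<le> card (D \<union> {})" using R h by (simp add: D_def)
  then obtain S c where "peel (D \<union> {}) R S c" "c \<in> R"
    using window_peel[OF FD _ us l4 i(1), of R] i(2) by metis
  then show ?thesis unfolding D_def by auto
qed

section \<open>The induction\<close>

lemma claw_edges_noncrossing:
  assumes "orient c x y \<noteq> 0"
  shows "noncrossing (c, x) (c, y)"
proof -
  have "z = c" if z: "z \<in> closed_segment c x" "z \<in> closed_segment c y" for z
  proof -
    obtain u where u: "z = (1 - u) *\<^sub>R c + u *\<^sub>R x" using z(1) by (auto simp: in_segment)
    obtain v where v: "z = (1 - v) *\<^sub>R c + v *\<^sub>R y" using z(2) by (auto simp: in_segment)
    have "orient c x z = 0" unfolding u by (simp add: orient_convex_comb)
    moreover have "orient c x z = v * orient c x y" unfolding v by (simp add: orient_convex_comb)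
    ultimately have "v = 0" using assms by simp
    then show ?thesis using v by simp
  qed
  then show ?thesis unfolding noncrossing_def by auto
qed

text \<open>The edges of an unobstructed star avoid those of any cover of the rest, whatever that
  cover is; two edges of the star itself meet only in the centre by general position.\<close>

lemma K13_coverable_peel:
  assumes gp: "general_position (R \<union> B)" and RB: "R \<inter> B = {}" and p: "peel (R \<union> B) R S c"
    and rest: "K13_coverable (R - S) (B - S)"
  shows "K13_coverable R B"
proof -
  have S: "S \<subseteq> R \<union> B" "c \<in> S" "card S = 4" "\<And>z. z \<in> S - {c} \<Longrightarrow> (z \<in> R) \<noteq> (c \<in> R)"
    and un: "unobstructed (R \<union> B) S c"
    using p unfolding peel_def by blast+
  obtain P ctr where P: "partition_on ((R - S) \<union> (B - S)) P"
    "\<And>T. T \<in> P \<Longrightarrow> card T = 4 \<and> ctr T \<in> T \<and>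
       (ctr T \<in> R - S \<and> T - {ctr T} \<subseteq> B - S \<or> ctr T \<in> B - S \<and> T - {ctr T} \<subseteq> R - S)"
    "pairwise noncrossing (star_edges P ctr)"
    using rest unfolding K13_coverable_def by blast
  have U: "\<Union>P = (R \<union> B) - S" using P(1) unfolding partition_on_def by blast
  have SP: "S \<notin> P" using U S(2) by blast
  define ctr' where "ctr' = ctr(S := c)"
  have ctr': "ctr' S = c" "\<And>T. T \<in> P \<Longrightarrow> ctr' T = ctr T" using SP by (auto simp: ctr'_def)
  have "disjnt S (\<Union>P)" using U by (auto simp: disjnt_def)
  moreover have "(R - S) \<union> (B - S) = (R \<union> B) - S" by blast
  ultimately have part: "partition_on (R \<union> B) (insert S P)"
    using partition_on_insert[of S P "R \<union> B"] P(1) S(1,2) by auto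
  have blocks: "card T = 4 \<and> ctr' T \<in> T \<and>
      (ctr' T \<in> R \<and> T - {ctr' T} \<subseteq> B \<or> ctr' T \<in> B \<and> T - {ctr' T} \<subseteq> R)" if "T \<in> insert S P" for T
  proof (cases "T = S")
    case True
    have "c \<in> R \<and> S - {c} \<subseteq> B \<or> c \<in> B \<and> S - {c} \<subseteq> R" using S by blast
    then show ?thesis using True S ctr' by simp
  next
    case False
    then have "T \<in> P" using that by blast
    then show ?thesis using P(2)[of T] ctr'(2)[of T] by auto
  qed
  have edges: "e \<in> star_edges P ctr \<or> (\<exists>x\<in>S - {c}. e = (c, x))" if "e \<in> star_edges (insert S P) ctr'" for e
    using that ctr' unfolding star_edges_def by auto
  have mem: "fst e \<in> R \<union> B - S \<and> snd e \<in> R \<union> B - S" if "e \<in> star_edges P ctr" for e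
    using that P(2) U unfolding star_edges_def by fastforce
  have mixed: "noncrossing (c, x) e \<and> noncrossing e (c, x)" if "x \<in> S - {c}" "e \<in> star_edges P ctr" for x e
  proof -
    have "closed_segment c x \<inter> closed_segment (fst e) (snd e) = {}"
      using un mem[OF that(2)] that(1) unfolding unobstructed_def by blast
    then show ?thesis unfolding noncrossing_def by auto
  qed
  have claw: "noncrossing (c, x) (c, y)" if "x \<in> S - {c}" "y \<in> S - {c}" "x \<noteq> y" for x y
    using that S by (intro claw_edges_noncrossing general_position_orient[OF gp]) auto
  have "pairwise noncrossing (star_edges (insert S P) ctr')"
  proof (rule pairwiseI)
    fix e f assume ef: "e \<in> star_edges (insert S P) ctr'" "f \<in> star_edges (insert S P) ctr'" "e \<noteq> f"
    show "noncrossing e f"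
      using edges[OF ef(1)] edges[OF ef(2)] ef(3) mixed claw P(3) unfolding pairwise_def by blast
  qed
  then show ?thesis unfolding K13_coverable_def using part blocks by blast
qed

lemma K13_coverable_empty: "K13_coverable {} {}"
  unfolding K13_coverable_def
  by (intro exI[of _ "{}"] exI[of _ id]) (simp add: partition_on_empty star_edges_def)

lemma peel_swap_colours:
  assumes "R \<inter> B = {}" "peel (R \<union> B) B S c"
  shows "peel (R \<union> B) R S c"
proof -
  have S: "S \<subseteq> R \<union> B" "c \<in> S" "\<And>z. z \<in> S - {c} \<Longrightarrow> (z \<in> B) \<noteq> (c \<in> B)"
    using assms(2) unfolding peel_def by auto
  have "x \<in> R \<longleftrightarrow> x \<notin> B" if "x \<in> S" for x using that S(1) assms(1) by auto
  then have "(z \<in> R) \<noteq> (c \<in> R)" if "z \<in> S - {c}" for z using S(2) S(3)[OF that] that by simp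
  then show ?thesis using assms(2) unfolding peel_def by simp
qed

lemma facing_chains_coverable:
  assumes "facing_chains C1 C2" "R \<union> B = C1 \<union> C2" "R \<inter> B = {}"
    "card R = 3 * g + h" "card B = g + 3 * h" "C1 \<noteq> {} \<and> C2 \<noteq> {} \<or> g = 0 \<or> h = 0"
  shows "K13_coverable R B"
  using assms
proof (induction "g + h" arbitrary: g h C1 C2 R B)
  case 0
  have "finite (R \<union> B)" using 0(2,3) unfolding facing_chains_def by auto
  moreover have "card R = 0" "card B = 0" using 0 by auto
  ultimately have "R = {}" "B = {}" by (auto simp del: Un_iff)
  then show ?case using K13_coverable_empty by simp
next
  case (Suc N)
  note F = Suc.prems(1) and X = Suc.prems(2) and RB = Suc.prems(3) and cards = Suc.prems(4,5)
  have "finite (R \<union> B)" and gp: "general_position (R \<union> B)"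
    using F X unfolding facing_chains_def by auto
  then have fin: "finite R" "finite B" by simp_all
  have cX: "card (C1 \<union> C2) = 4 * (g + h)"
    using card_Un_disjoint[OF fin RB] cards unfolding X by simp
  have sub: "R \<subseteq> C1 \<union> C2" "B \<subseteq> C1 \<union> C2" using X by auto
  obtain S c where S: "peel (R \<union> B) R S c"
    and c: "c \<in> R \<Longrightarrow> 1 \<le> h" "c \<notin> R \<Longrightarrow> 1 \<le> g"
    \<comment> \<open>The invariant after the removal: a red centre lowers \<open>h\<close> and a
      blue centre lowers \<open>g\<close>, and \<open>h \<le> 1\<close> or \<open>g \<le> 1\<close>
      says that the lowered parameter becomes 0.\<close>
    and rest: "(C1 - S \<noteq> {} \<and> C2 - S \<noteq> {}) \<or> (c \<in> R \<and> (g = 0 \<or> h \<le> 1)) \<or> (c \<notin> R \<and> (g \<le> 1 \<or> h = 0))"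
  proof -
    consider "g + h = 1" | "1 \<le> g" "1 \<le> h" | "g = 0" "2 \<le> h" | "h = 0" "2 \<le> g"
      using Suc.hyps(2) by linarith
    then show thesis
    proof cases
      case 1
      then have c4: "card (R \<union> B) = 4" using cX X by simp
      have vac: "unobstructed (R \<union> B) (R \<union> B) c" for c unfolding unobstructed_def by blast
      consider "card R = 1" "g = 0" "h = 1" | "card B = 1" "g = 1" "h = 0" using 1 cards by (cases g) auto
      then show thesis
      proof cases
        case 1
        then obtain c where c: "R = {c}" by (auto simp: card_1_singleton_iff)
        have "peel (R \<union> B) R (R \<union> B) c"
          unfolding peel_def using c4 vac RB c by auto
        then show thesis using 1 c by (intro that[of "R \<union> B" c]) auto
      next
        case 2
        then obtain c where c: "B = {c}" by (auto simp: card_1_singleton_iff)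
        have "peel (R \<union> B) R (R \<union> B) c"
          unfolding peel_def using c4 vac RB c by auto
        then show thesis using 2 c RB by (intro that[of "R \<union> B" c]) auto
      qed
    next
      case 2
      then have "C1 \<noteq> {}" "C2 \<noteq> {}" using Suc.prems(6) by auto
      then obtain S c where "peel (C1 \<union> C2) R S c" "(C1 - S \<noteq> {} \<and> C2 - S \<noteq> {}) \<or> g + h = 2"
        using peel_exists_mixed[OF F _ _ sub(1) cX cards(1) 2] by blast
      \<comment> \<open>With \<open>g + h = 2\<close> both parameters are 1, so either choice of the
        centre's colour makes one of them 0.\<close>
      then show thesis using 2 X by (intro that[of S c]) auto
    next
      case 3
      then obtain S c where "peel (C1 \<union> C2) R S c" "c \<in> R"
        using peel_exists_single[OF F sub(1), of h] cX cards by auto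
      then show thesis using 3 X by (intro that[of S c]) auto
    next
      case 4
      then obtain S c where "peel (R \<union> B) B S c" "c \<in> B"
        using peel_exists_single[OF F sub(2), of g] cX cards X by auto
      then show thesis using 4 RB peel_swap_colours[OF RB] by (intro that[of S c]) auto
    qed
  qed
  have S': "S \<subseteq> R \<union> B" "c \<in> S" "card S = 4" "\<And>z. z \<in> S - {c} \<Longrightarrow> (z \<in> R) \<noteq> (c \<in> R)"
    using S unfolding peel_def by blast+
  have F': "facing_chains (C1 - S) (C2 - S)" by (rule facing_chains_subset[OF F]) auto
  have X': "(R - S) \<union> (B - S) = (C1 - S) \<union> (C2 - S)" using X by blast
  have RB': "(R - S) \<inter> (B - S) = {}" using RB by blast
  have finS: "finite S" using S' fin finite_subset by blast
  have c3: "card (S - {c}) = 3" using S' finS by simp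
  have diff: "card (R - S) = card R - card (R \<inter> S)" "card (B - S) = card B - card (B \<inter> S)"
    using fin by (simp_all add: card_Diff_subset_Int)
  have "K13_coverable (R - S) (B - S)"
  proof (cases "c \<in> R")
    case True
    then have i: "R \<inter> S = {c}" "B \<inter> S = S - {c}" using S' RB by blast+
    have "card (R - S) = 3 * g + h - 1" "card (B - S) = g + 3 * h - 3"
      unfolding diff i c3 cards by simp_all
    then have cd: "card (R - S) = 3 * g + (h - 1)" "card (B - S) = g + 3 * (h - 1)" using c(1)[OF True] by auto
    show ?thesis
      by (rule Suc.hyps(1)[OF _ F' X' RB' cd]) (use Suc.hyps(2) c(1)[OF True] rest True in auto)
  next
    case False
    then have i: "B \<inter> S = {c}" "R \<inter> S = S - {c}" using S' RB by blast+
    have "card (B - S) = g + 3 * h - 1" "card (R - S) = 3 * g + h - 3"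
      unfolding diff i c3 cards by simp_all
    then have cd: "card (R - S) = 3 * (g - 1) + h" "card (B - S) = (g - 1) + 3 * h" using c(2)[OF False] by auto
    show ?thesis
      by (rule Suc.hyps(1)[OF _ F' X' RB' cd]) (use Suc.hyps(2) c(2)[OF False] rest False in auto)
  qed
  then show ?case by (rule K13_coverable_peel[OF gp RB S])
qed

theorem theorem11:
  fixes g h :: nat and R B :: "(real^2) set"
  assumes "finite R" and "finite B" and "R \<inter> B = {}"
    and "card R = 3 * g + h" and "card B = g + 3 * h"
    and "double_chain (R \<union> B)"
    and "general_position (R \<union> B)"
  shows "K13_coverable R B"
proof -
  obtain C1 C2 where C: "R \<union> B = C1 \<union> C2" "C1 \<inter> C2 = {}" "C1 \<noteq> {}" "C2 \<noteq> {}"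
      "convex_position C1" "convex_position C2"
      "\<forall>p\<in>C1. \<forall>q\<in>C2. closed_segment p q \<inter> convex hull C1 = {p} \<and> closed_segment p q \<inter> convex hull C2 = {q}"
    using assms(6) unfolding double_chain_def by blast
  have "finite (C1 \<union> C2)" using assms(1,2) C(1) by (metis finite_UnI)
  then have "facing_chains C1 C2" using C assms(7) unfolding facing_chains_def by simp
  then show ?thesis using facing_chains_coverable[OF _ C(1) assms(3-5)] C(3,4) by blast
qed

end
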